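(* Let $1\le\rho\le 2$ and let $T_0,T_1\in C_\rho(H)$. Then: (i) If $\rho=1$ and $T_1$ is Harnack dominated by $T_0$ in $C_\rho(H)$, then $\overline{W(T_0)}\cap\mathbb{T}=\overline{W(T_1)}\cap\mathbb{T}$. (ii) If $1<\rho\le 2$, $T_1$ is Harnack dominated by $T_0$ in $C_\rho(H)$ and $\Gamma(T_0)=\emptyset$, then $\overline{W(T_0)}\cap\mathbb{T}\subseteq\overline{W(T_1)}\cap\mathbb{T}$. (iii) If $T_1$ and $T_0$ are Harnack equivalent in $C_\rho(H)$, then $\overline{W(T_0)}\cap\mathbb{T}=\overline{W(T_1)}\cap\mathbb{T}$.
   Context: $H$ is a complex Hilbert space and $B(H)$ is the algebra of bounded linear operators on $H$; $\mathbb{D}$ is the open unit disc and $\mathbb{T}$ the unit circle. For $\rho>0$, $C_\rho(H)$ is the set of all $T\in B(H)$ admitting a unitary $\rho$-dilation: there are a Hilbert space $\mathcal{H}$ containing $H$ as a closed subspace and a unitary $U\in B(\mathcal{H})$ with $T^n=\rho P_H U^n|_H$ for all integers $n\ge 1$, where $P_H$ is the orthogonal projection of $\mathcal H$ onto $H$. Every $T\in C_\rho(H)$ has $\sigma(T)\subseteq\overline{\mathbb{D}}$, and its $\rho$-kernel is $K_z^\rho(T)=(I-\overline{z}T)^{-1}+(I-zT^* )^{-1}+(\rho-2)I$ for $z\in\mathbb{D}$. For $T_0,T_1\in C_\rho(H)$, $T_1$ is Harnack dominated by $T_0$ in $C_\rho(H)$ if there is a constant $c\ge 1$ with $K_z^\rho(T_1)\le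 c^2K_z^\rho(T_0)$ for all $z\in\mathbb{D}$; they are Harnack equivalent if each is Harnack dominated by the other. $\Gamma(T)=\sigma(T)\cap\mathbb{T}$, and $W(T)=\{\langle Tx,x\rangle: x\in H,\ \|x\|=1\}$ is the numerical range, with closure $\overline{W(T)}$. *)

theory Defs
  imports "HOL-Analysis.Analysis"
begin

text \<open>
  Complex Hilbert spaces. The inherited real inner product is the real part of the complex one,
  so that norm, topology and completeness are those of the library. The complex inner product is
  linear in its first argument.
\<close>

class complex_hilbert_space = real_inner + complete_space +
  fixes scaleC :: "complex \<Rightarrow> 'a \<Rightarrow> 'a" (infixr "*\<^sub>C" 75)
    and cinner :: "'a \<Rightarrow> 'a \<Rightarrow> complex"
  assumes scaleC_add_right: "a *\<^sub>C (x + y) = a *\<^sub>C x + a *\<^sub>C y"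
    and scaleC_add_left: "(a + b) *\<^sub>C x = a *\<^sub>C x + b *\<^sub>C x"
    and scaleC_scaleC: "a *\<^sub>C b *\<^sub>C x = (a * b) *\<^sub>C x"
    and scaleC_of_real: "complex_of_real r *\<^sub>C x = r *\<^sub>R x"
    and cinner_commute: "cinner x y = cnj (cinner y x)"
    and cinner_add_left: "cinner (x + y) w = cinner x w + cinner y w"
    and cinner_scaleC_left: "cinner (a *\<^sub>C x) y = a * cinner x y"
    and Re_cinner: "Re (cinner x y) = inner x y"

instantiation complex :: complex_hilbert_space
begin

definition scaleC_complex :: "complex \<Rightarrow> complex \<Rightarrow> complex" where
  "scaleC_complex a x = a * x"

definition cinner_complex :: "complex \<Rightarrow> complex \<Rightarrow> complex" where
  "cinner_complex x y = x * cnj y"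

instance
  by standard
    (auto simp: scaleC_complex_def cinner_complex_def algebra_simps scaleR_conv_of_real
      inner_complex_def)

end

definition bounded_clinear :: "('a::complex_hilbert_space \<Rightarrow> 'b::complex_hilbert_space) \<Rightarrow> bool" where
  "bounded_clinear T \<longleftrightarrow> bounded_linear T \<and> (\<forall>c x. T (c *\<^sub>C x) = c *\<^sub>C T x)"

text \<open>The next two descriptions are meant for bounded \<open>T\<close> and for closed subspaces \<open>M\<close>.\<close>

definition cadjoint :: "('a::complex_hilbert_space \<Rightarrow> 'a) \<Rightarrow> 'a \<Rightarrow> 'a" where
  "cadjoint T = (THE S. \<forall>x y. cinner (T x) y = cinner x (S y))"

definition orth_proj :: "'a::complex_hilbert_space set \<Rightarrow> 'a \<Rightarrow> 'a" where
  "orth_proj M x = (THE y. y \<in> M \<and> (\<forall>m\<in>M. cinner (x - y) m = 0))"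

definition unitary_op :: "('a::complex_hilbert_space \<Rightarrow> 'a) \<Rightarrow> bool" where
  "unitary_op U \<longleftrightarrow> bounded_clinear U \<and> cadjoint U \<circ> U = id \<and> U \<circ> cadjoint U = id"

definition isometric_embedding ::
  "('a::complex_hilbert_space \<Rightarrow> 'k::complex_hilbert_space) \<Rightarrow> bool" where
  "isometric_embedding J \<longleftrightarrow> bounded_clinear J \<and> (\<forall>x y. cinner (J x) (J y) = cinner x y)"

text \<open>
  The space \<open>H\<close> is the type \<open>'a\<close>; it is regarded as the closed subspace \<open>range J\<close> of the larger
  Hilbert space \<open>'k\<close>.
\<close>

definition unitary_rho_dilation ::
  "real \<Rightarrow> ('a::complex_hilbert_space \<Rightarrow> 'a) \<Rightarrow> ('a \<Rightarrow> 'k::complex_hilbert_space) \<Rightarrow> ('k \<Rightarrow> 'k) \<Rightarrow> bool" where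
  "unitary_rho_dilation \<rho> T J U \<longleftrightarrow>
     isometric_embedding J \<and> unitary_op U \<and>
     (\<forall>n\<ge>1. \<forall>x. J ((T ^^ n) x) = \<rho> *\<^sub>R orth_proj (range J) ((U ^^ n) (J x)))"

text \<open>
  HOL cannot quantify existentially over types, so the dilation space is a type argument. Since
  membership in this class occurs only as a hypothesis, a theorem in which \<open>'k\<close> is a type variable
  covers the existence of a dilation on an arbitrary Hilbert space.
\<close>

definition C_rho :: "'k::complex_hilbert_space itself \<Rightarrow> real \<Rightarrow> ('a::complex_hilbert_space \<Rightarrow> 'a) set" where
  "C_rho _ \<rho> = {T. bounded_clinear T \<and>
     (\<exists>(J :: 'a \<Rightarrow> 'k) U. unitary_rho_dilation \<rho> T J U)}"

definition op_spectrum :: "('a::complex_hilbert_space \<Rightarrow> 'a) \<Rightarrow> complex set" where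
  "op_spectrum T = {\<mu>. \<not> (\<exists>S. bounded_clinear S \<and>
     (\<lambda>x. T x - \<mu> *\<^sub>C x) \<circ> S = id \<and> S \<circ> (\<lambda>x. T x - \<mu> *\<^sub>C x) = id)}"

definition peripheral_spectrum :: "('a::complex_hilbert_space \<Rightarrow> 'a) \<Rightarrow> complex set" where
  "peripheral_spectrum T = op_spectrum T \<inter> sphere 0 1"

definition numerical_range :: "('a::complex_hilbert_space \<Rightarrow> 'a) \<Rightarrow> complex set" where
  "numerical_range T = {cinner (T x) x | x. norm x = 1}"

text \<open>
  For \<open>z\<close> in the open unit disc and \<open>op_spectrum T \<subseteq> cball 0 1\<close> both operators inverted here are
  bijective, with bounded inverse.
\<close>

definition rho_kernel :: "real \<Rightarrow> complex \<Rightarrow> ('a::complex_hilbert_space \<Rightarrow> 'a) \<Rightarrow> 'a \<Rightarrow> 'a" where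
  "rho_kernel \<rho> z T x =
     inv (\<lambda>y. y - cnj z *\<^sub>C T y) x + inv (\<lambda>y. y - z *\<^sub>C cadjoint T y) x + (\<rho> - 2) *\<^sub>R x"

definition op_le :: "('a::complex_hilbert_space \<Rightarrow> 'a) \<Rightarrow> ('a \<Rightarrow> 'a) \<Rightarrow> bool" where
  "op_le A B \<longleftrightarrow> (\<forall>x. cinner (B x - A x) x \<in> \<real>\<^sub>\<ge>\<^sub>0)"

text \<open>\<open>harnack_dominated \<rho> T1 T0\<close>: the operator \<open>T1\<close> is dominated by \<open>T0\<close>.\<close>

definition harnack_dominated ::
  "real \<Rightarrow> ('a::complex_hilbert_space \<Rightarrow> 'a) \<Rightarrow> ('a \<Rightarrow> 'a) \<Rightarrow> bool" where
  "harnack_dominated \<rho> T1 T0 \<longleftrightarrow>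
     (\<exists>c\<ge>1. \<forall>z\<in>ball 0 1. op_le (rho_kernel \<rho> z T1) (\<lambda>x. c\<^sup>2 *\<^sub>R rho_kernel \<rho> z T0 x))"

definition harnack_equivalent ::
  "real \<Rightarrow> ('a::complex_hilbert_space \<Rightarrow> 'a) \<Rightarrow> ('a \<Rightarrow> 'a) \<Rightarrow> bool" where
  "harnack_equivalent \<rho> T1 T0 \<longleftrightarrow> harnack_dominated \<rho> T1 T0 \<and> harnack_dominated \<rho> T0 T1"

end

theory Submission
  imports Defs "HOL-Complex_Analysis.Complex_Analysis"
begin

text \<open>
  For \<open>x = y - cnj z T y\<close> the quadratic form of the kernel is
  \<open>\<langle>K\<^sub>z x, x\<rangle> = 2 Re \<langle>y, y - cnj z T y\<rangle> - (2 - \<rho>) \<parallel>y - cnj z T y\<parallel>\<^sup>2\<close>; the dilation makes it nonnegative.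
  Letting \<open>z\<close> tend to a point \<open>\<mu>\<close> of the circle, one sees that \<open>W(T)\<close> lies in the closed disc, and that for
  \<open>\<rho> < 2\<close> every \<open>\<mu>\<close> in the closure of \<open>W(T)\<close> is an approximate eigenvalue; the converse holds for every \<open>\<rho>\<close>.

  Let \<open>T1\<close> be dominated by \<open>T0\<close>. Blow-up of the kernel along the radius to \<open>\<mu>\<close> passes from \<open>T1\<close> to \<open>T0\<close>,
  so approximate eigenvalues of \<open>T1\<close> on the circle are approximate eigenvalues of \<open>T0\<close>. If \<open>\<mu>\<close> is not an
  approximate eigenvalue of \<open>T0\<close>, the kernel inequality extends to \<open>\<mu>\<close>, and there it carries points of
  the closure of \<open>W(T0)\<close> over to \<open>W(T1)\<close>. For \<open>\<rho> = 1\<close> this exception is not needed: comparing the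
  coefficients of order 0 and 1 of the kernels gives \<open>1 - Re (cnj \<mu> T1) \<le> c\<^sup>2 (1 - Re (cnj \<mu> T0))\<close>.
\<close>

subsection \<open>Complex Hilbert spaces\<close>

instance complex_hilbert_space \<subseteq> banach ..

lemma scaleC_one [simp]: "1 *\<^sub>C (x::'a::complex_hilbert_space) = x"
  using scaleC_of_real[of 1 x] by simp

lemma cinner_self: "cinner x x = complex_of_real ((norm x)\<^sup>2)"
  using arg_cong[OF cinner_commute[of x x], of Im] Re_cinner[of x x]
  by (simp add: complex_eq_iff power2_norm_eq_inner)

lemma cinner_scaleC_right: "cinner x (a *\<^sub>C y) = cnj a * cinner x y"
  by (metis cinner_scaleC_left cinner_commute complex_cnj_mult)

lemma norm_scaleC [simp]: "norm (a *\<^sub>C x) = cmod a * norm (x::'a::complex_hilbert_space)"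
proof -
  have "complex_of_real ((norm (a *\<^sub>C x))\<^sup>2) = a * cnj a * complex_of_real ((norm x)\<^sup>2)"
    unfolding cinner_self[symmetric] by (simp add: cinner_scaleC_left cinner_scaleC_right)
  also have "\<dots> = complex_of_real ((cmod a * norm x)\<^sup>2)"
    by (simp add: complex_norm_square[symmetric] power_mult_distrib)
  finally have "(norm (a *\<^sub>C x))\<^sup>2 = (cmod a * norm x)\<^sup>2"
    using of_real_eq_iff by blast
  then show ?thesis by simp
qed

lemma bounded_linear_scaleC: "bounded_linear (\<lambda>x::'a::complex_hilbert_space. a *\<^sub>C x)"
proof (rule bounded_linear_intro[where K = "cmod a"])
  show "a *\<^sub>C r *\<^sub>R x = r *\<^sub>R a *\<^sub>C x" for r and x :: 'a
    by (simp flip: scaleC_of_real add: scaleC_scaleC mult.commute)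
qed (auto simp: scaleC_add_right)

lemmas scaleC_diff_right = bounded_linear.linear[OF bounded_linear_scaleC, THEN linear_diff]
lemmas scaleC_scaleR = bounded_linear.linear[OF bounded_linear_scaleC, THEN linear_cmul]

lemma Im_cinner: "Im (cinner x y) = inner (- \<i> *\<^sub>C x) y"
  by (simp add: cinner_scaleC_left flip: Re_cinner)

lemma inner_scaleC: "inner (a *\<^sub>C x) y = Re (a * cinner x y)"
  by (simp add: cinner_scaleC_left flip: Re_cinner)

lemma cinner_eqI:
  assumes "\<And>a. inner (a *\<^sub>C x) y = inner (a *\<^sub>C u) v"
  shows "cinner x y = cinner u v"
  using assms[of 1] assms[of "-\<i>"] by (simp add: complex_eq_iff Im_cinner Re_cinner)

lemma bounded_linear_cinner_left: "bounded_linear (\<lambda>x::'a::complex_hilbert_space. cinner x y)"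
proof (rule bounded_linear_intro[where K = "2 * norm y"])
  show "cinner (r *\<^sub>R x) y = r *\<^sub>R cinner x y" for r and x :: 'a
    using cinner_scaleC_left[of "complex_of_real r" x y]
    by (simp only: scaleC_of_real scaleR_conv_of_real)
  show "cmod (cinner x y) \<le> norm x * (2 * norm y)" for x :: 'a
    using cmod_le[of "cinner x y"] Cauchy_Schwarz_ineq2[of x y]
      Cauchy_Schwarz_ineq2[of "- \<i> *\<^sub>C x" y] by (simp add: Im_cinner Re_cinner)
qed (rule cinner_add_left)

lemmas cinner_diff_left = bounded_linear.linear[OF bounded_linear_cinner_left, THEN linear_diff]

section \<open>Orthogonal projections, Riesz representation and adjoints\<close>

lemma projection_exists:
  fixes M :: "'a::real_inner set"
  assumes "complete M" and M: "subspace M"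
  obtains y where "y \<in> M" and "\<And>m. m \<in> M \<Longrightarrow> inner (x - y) m = 0"
proof -
  have ne: "M \<noteq> {}" using subspace_0[OF M] by blast
  define d where "d = infdist x M"
  have d0: "0 \<le> d" by (simp add: d_def infdist_nonneg)
  have lower: "d \<le> norm (x - y)" if "y \<in> M" for y
    using infdist_le[OF that, of x] by (simp add: d_def dist_norm)
  have "\<exists>y\<in>M. norm (x - y) < d + 1 / Suc n" for n
  proof -
    have "(INF y\<in>M. dist x y) < d + 1 / Suc n" using ne by (simp add: d_def infdist_def)
    then obtain y where "y \<in> M" "dist x y < d + 1 / Suc n"
      using cINF_less_iff[OF ne, of "dist x"] by (auto intro: bdd_belowI2[where m = 0])
    then show ?thesis by (auto simp: dist_norm)
  qed
  then obtain f where fM: "\<And>n. f n \<in> M" and f: "\<And>n. norm (x - f n) < d + 1 / Suc n" by metis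
  \<comment> \<open>The midpoint of \<open>f m\<close> and \<open>f n\<close> lies in
    \<open>M\<close>, hence at distance at least \<open>d\<close> from \<open>x\<close>; the
    parallelogram law then makes the minimizing sequence Cauchy.\<close>
  have close: "(norm (f m - f n))\<^sup>2 \<le> (4 * d + 2) * (1 / Suc m + 1 / Suc n)" for m n
  proof -
    define a b where "a = x - f m" and "b = x - f n"
    have sq: "(norm (x - f k))\<^sup>2 \<le> d\<^sup>2 + (2 * d + 1) * (1 / Suc k)" for k
    proof -
      have "(norm (x - f k))\<^sup>2 \<le> (d + 1 / Suc k)\<^sup>2" using f[of k] by (intro power_mono) auto
      also have "\<dots> = d\<^sup>2 + (2 * d + 1 / Suc k) * (1 / Suc k)" by (simp add: power2_eq_square algebra_simps)
      also have "\<dots> \<le> d\<^sup>2 + (2 * d + 1) * (1 / Suc k)"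
        by (intro add_left_mono mult_right_mono) auto
      finally show ?thesis .
    qed
    have "(1/2) *\<^sub>R (f m + f n) \<in> M" using M fM by (simp add: subspace_add subspace_mul)
    then have "d \<le> norm (x - (1/2) *\<^sub>R (f m + f n))" by (rule lower)
    also have "x - (1/2) *\<^sub>R (f m + f n) = (1/2) *\<^sub>R (a + b)"
      by (simp add: a_def b_def algebra_simps flip: scaleR_left.add)
    finally have "(2 * d)\<^sup>2 \<le> (norm (a + b))\<^sup>2" using d0 by (intro power_mono) auto
    moreover have "(norm (a - b))\<^sup>2 + (norm (a + b))\<^sup>2 = 2 * (norm a)\<^sup>2 + 2 * (norm b)\<^sup>2"
      by (simp add: power2_norm_eq_inner inner_simps)
    moreover have "(norm a)\<^sup>2 \<le> d\<^sup>2 + (2 * d + 1) * (1 / Suc m)"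
      "(norm b)\<^sup>2 \<le> d\<^sup>2 + (2 * d + 1) * (1 / Suc n)"
      using sq[of m] sq[of n] by (simp_all only: a_def b_def)
    moreover have "(2 * d)\<^sup>2 = 4 * d\<^sup>2" by (simp add: power2_eq_square)
    ultimately have "(norm (a - b))\<^sup>2 \<le> 2 * ((2 * d + 1) * (1 / Suc m)) + 2 * ((2 * d + 1) * (1 / Suc n))"
      by linarith
    also have "\<dots> = (4 * d + 2) * (1 / Suc m + 1 / Suc n)" by (simp add: distrib_left distrib_right)
    also have "norm (a - b) = norm (f m - f n)" by (simp add: a_def b_def norm_minus_commute)
    finally show ?thesis .
  qed
  have "Cauchy f"
  proof (rule metric_CauchyI)
    fix e :: real assume e: "0 < e"
    obtain N where N: "1 / Suc N < e\<^sup>2 / (4 * d + 2) / 2"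
      using nat_approx_posE[of "e\<^sup>2 / (4 * d + 2) / 2"] e d0
      by (metis add_nonneg_pos mult_nonneg_nonneg zero_less_divide_iff zero_less_numeral zero_le_numeral
          zero_less_power)
    show "\<exists>N. \<forall>m\<ge>N. \<forall>n\<ge>N. dist (f m) (f n) < e"
    proof (intro exI allI impI)
      fix m n assume "N \<le> m" "N \<le> n"
      then have "1 / Suc m + 1 / Suc n \<le> 2 * (1 / Suc N)"
        by (smt (verit) Suc_le_mono frac_le of_nat_0_less_iff of_nat_le_iff zero_less_Suc)
      also have "\<dots> < e\<^sup>2 / (4 * d + 2)" using N
        by (simp only: less_divide_eq_numeral1 mult.commute)
      finally have "(4 * d + 2) * (1 / Suc m + 1 / Suc n) < e\<^sup>2"
        using d0 by (simp add: pos_less_divide_eq mult.commute)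
      with close[of m n] have "(norm (f m - f n))\<^sup>2 < e\<^sup>2" by simp
      with e show "dist (f m) (f n) < e" by (simp add: dist_norm power_less_imp_less_base)
    qed
  qed
  with \<open>complete M\<close> fM obtain y where y: "y \<in> M" "f \<longlonglongrightarrow> y" unfolding complete_def by blast
  have "norm (x - y) \<le> d"
  proof (rule LIMSEQ_le)
    show "(\<lambda>n. norm (x - f n)) \<longlonglongrightarrow> norm (x - y)" using y(2) by (intro tendsto_intros)
    show "(\<lambda>n. d + 1 / Suc n) \<longlonglongrightarrow> d"
      using tendsto_add[OF tendsto_const[of d] LIMSEQ_inverse_real_of_nat] by (simp add: inverse_eq_divide)
  qed (use f in \<open>auto intro: less_imp_le\<close>)
  with lower[OF y(1)] have nd: "norm (x - y) = d" by simp
  have "inner (x - y) m = 0" if m: "m \<in> M" for m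
  proof (cases "m = 0")
    case False
    \<comment> \<open>This \<open>t\<close> minimizes the distance from \<open>x\<close> to
      \<open>y + t *\<^sub>R m\<close>; since \<open>y\<close> is already nearest, the decrease it
      would bring must be zero.\<close>
    define t where "t = inner (x - y) m / (norm m)\<^sup>2"
    have "d \<le> norm (x - (y + t *\<^sub>R m))"
      using M y(1) m by (intro lower subspace_add subspace_mul)
    then have "(norm (x - y))\<^sup>2 \<le> (norm (x - y - t *\<^sub>R m))\<^sup>2"
      using d0 by (intro power_mono) (auto simp: nd algebra_simps)
    also have "\<dots> = (norm (x - y))\<^sup>2 - 2 * t * inner (x - y) m + t\<^sup>2 * (norm m)\<^sup>2"
      unfolding power2_norm_eq_inner
      by (simp add: inner_simps inner_commute power2_eq_square algebra_simps)
    also have "\<dots> = (norm (x - y))\<^sup>2 - (inner (x - y) m)\<^sup>2 / (norm m)\<^sup>2"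
      using False by (simp add: t_def power2_eq_square field_simps)
    finally show ?thesis using False by (simp add: divide_le_0_iff)
  qed simp
  with y(1) that show ?thesis by blast
qed

text \<open>If \<open>v\<close> is orthogonal to the kernel of \<open>\<phi>\<close> and
  \<open>\<phi> v\<close> is nonzero, every \<open>x\<close> is a multiple of \<open>v\<close> plus
  an element of the kernel.\<close>

lemma riesz_representation:
  fixes \<phi> :: "'a::{real_inner,complete_space} \<Rightarrow> real"
  assumes "bounded_linear \<phi>"
  obtains y where "\<And>x. \<phi> x = inner x y"
proof (cases "\<forall>x. \<phi> x = 0")
  case True
  then show ?thesis using that[of 0] by simp
next
  case False
  then obtain u where u: "\<phi> u \<noteq> 0" by blast
  note lin = bounded_linear.linear[OF assms]
  let ?M = "\<phi> -` {0}"
  have "closed ?M"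
    using assms by (intro continuous_closed_vimage) (auto simp: linear_continuous_at)
  moreover have "subspace ?M" using lin by (simp add: subspace_def linear_0 linear_add linear_cmul)
  ultimately obtain p where p: "\<phi> p = 0" "\<And>m. \<phi> m = 0 \<Longrightarrow> inner (u - p) m = 0"
    using projection_exists[of ?M u] by (auto simp: complete_eq_closed)
  define v where "v = u - p"
  have v: "\<phi> v = \<phi> u" using p(1) by (simp add: v_def linear_diff[OF lin])
  have v0: "v \<noteq> 0" using v u linear_0[OF lin] by auto
  have "\<phi> x = inner x ((\<phi> v / (norm v)\<^sup>2) *\<^sub>R v)" for x
  proof -
    have "\<phi> (x - (\<phi> x / \<phi> v) *\<^sub>R v) = 0" using u v by (simp add: linear_diff[OF lin] linear_cmul[OF lin])
    then have "inner v (x - (\<phi> x / \<phi> v) *\<^sub>R v) = 0" using p(2) by (simp add: v_def)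
    then have "inner v x = \<phi> x / \<phi> v * (norm v)\<^sup>2"
      by (simp add: inner_diff_right power2_norm_eq_inner)
    then show ?thesis using u v v0 by (simp add: inner_commute[of x] field_simps)
  qed
  then show ?thesis by (rule that)
qed

text \<open>Riesz representation yields an adjoint for the real inner product; testing it on all
  complex multiples of \<open>x\<close> gives the complex identity, and uniqueness justifies the
  description by \<open>THE\<close>.\<close>

lemma cadjoint_cinner:
  fixes T :: "'a::complex_hilbert_space \<Rightarrow> 'a"
  assumes "bounded_clinear T"
  shows "cinner (T x) y = cinner x (cadjoint T y)"
proof -
  from assms have bl: "bounded_linear T" and sc: "\<And>c x. T (c *\<^sub>C x) = c *\<^sub>C T x"
    by (auto simp: bounded_clinear_def)
  have "\<exists>s. \<forall>x. inner (T x) y = inner x s" for y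
    using riesz_representation[OF bounded_linear_compose[OF bounded_linear_inner_left bl, of y]]
    by metis
  then obtain S where S: "\<And>x y. inner (T x) y = inner x (S y)" by metis
  have "\<forall>x y. cinner (T x) y = cinner x (S y)"
    by (intro allI cinner_eqI) (metis S sc)
  moreover have "S' = S" if "\<forall>x y. cinner (T x) y = cinner x (S' y)" for S'
  proof
    fix y
    have "inner x (S' y) = inner x (S y)" for x using that S by (metis Re_cinner)
    then show "S' y = S y" by (metis inner_eq_zero_iff inner_diff_right right_minus_eq)
  qed
  ultimately have "\<forall>x y. cinner (T x) y = cinner x (cadjoint T y)"
    unfolding cadjoint_def by (rule theI)
  then show ?thesis by blast
qed

text \<open>The range is complete because \<open>J\<close> is isometric, and real orthogonality to
  it is complex orthogonality because it is closed under multiplication by the imaginary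
  unit.\<close>

lemma orth_proj_range:
  fixes J :: "'a::complex_hilbert_space \<Rightarrow> 'k::complex_hilbert_space"
  assumes "isometric_embedding J"
  shows "cinner (orth_proj (range J) v) (J y) = cinner v (J y)"
proof -
  from assms have bl: "bounded_linear J" and sc: "\<And>c x. J (c *\<^sub>C x) = c *\<^sub>C J x"
    and iso: "\<And>x y. cinner (J x) (J y) = cinner x y"
    by (auto simp: isometric_embedding_def bounded_clinear_def)
  have nJ: "norm (J x) = norm x" for x
    using iso[of x x] by (simp add: cinner_self del: of_real_power)
  have "complete (range J)"
    by (rule complete_isometric_image[OF zero_less_one subspace_UNIV bl]) (auto simp: nJ)
  moreover have sub: "subspace (range J)"
    using bounded_linear.linear[OF bl] subspace_UNIV by (rule linear_subspace_image)
  ultimately obtain p where p: "p \<in> range J" "\<And>m. m \<in> range J \<Longrightarrow> inner (v - p) m = 0"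
    using projection_exists by blast
  have "cinner (v - p) m = 0" if "m \<in> range J" for m
  proof -
    have im: "\<i> *\<^sub>C m \<in> range J" using that sc by (metis rangeE rangeI)
    have "Re (cinner (v - p) (\<i> *\<^sub>C m)) = 0" using p(2)[OF im] by (simp add: Re_cinner)
    moreover have "Re (cinner (v - p) m) = 0" using p(2)[OF that] by (simp add: Re_cinner)
    ultimately show ?thesis by (simp add: cinner_scaleC_right complex_eq_iff)
  qed
  then have "p \<in> range J \<and> (\<forall>m\<in>range J. cinner (v - p) m = 0)" using p(1) by blast
  moreover have "q = p" if "q \<in> range J \<and> (\<forall>m\<in>range J. cinner (v - q) m = 0)" for q
  proof -
    have "q - p \<in> range J" using sub that p(1) by (simp add: subspace_diff)
    then have "inner (v - q) (q - p) = 0" "inner (v - p) (q - p) = 0"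
      using that p(2) by (auto simp flip: Re_cinner)
    then have "inner (q - p) (q - p) = 0" by (simp add: inner_simps)
    then show ?thesis by simp
  qed
  ultimately have "orth_proj (range J) v \<in> range J \<and> (\<forall>m\<in>range J. cinner (v - orth_proj (range J) v) m = 0)"
    unfolding orth_proj_def by (rule theI)
  then show ?thesis by (simp add: cinner_diff_left)
qed

subsection \<open>Resolvents of power bounded operators\<close>

text \<open>The terms telescope, and \<open>(A ^^ n) y\<close> tends to 0. The bound concerns the
  powers and not the norm of \<open>A\<close>, because operators with a
  \<open>\<rho>\<close>-dilation may have norm above 1.\<close>

lemma neumann_sums:
  fixes A :: "'a::banach \<Rightarrow> 'a"
  assumes A: "bounded_linear A"
    and bound: "\<And>n x. norm ((A ^^ n) x) \<le> M * r ^ n * norm x" and r: "0 \<le> r" "r < 1"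
    and y: "y - A y = x"
  shows "(\<lambda>n. (A ^^ n) x) sums y"
proof -
  note lin = bounded_linear.linear[OF A]
  have An: "(A ^^ n) x = (A ^^ n) y - (A ^^ Suc n) y" for n
  proof (induction n)
    case (Suc n)
    have "(A ^^ Suc n) x = A ((A ^^ n) y - (A ^^ Suc n) y)" using Suc by simp
    then show ?case by (simp add: linear_diff[OF lin])
  qed (simp flip: y)
  have "(\<lambda>n. M * norm y * r ^ n) \<longlonglongrightarrow> 0"
    using r by (intro tendsto_mult_right_zero LIMSEQ_power_zero) auto
  moreover have "\<forall>\<^sub>F n in sequentially. norm ((A ^^ n) y) \<le> M * norm y * r ^ n"
    using bound[of _ y] by (simp add: mult_ac)
  ultimately have "(\<lambda>n. (A ^^ n) y) \<longlonglongrightarrow> 0"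
    by (rule Lim_null_comparison[rotated])
  from telescope_sums'[OF this] show ?thesis by (simp add: An)
qed

lemma neumann_exists:
  fixes A :: "'a::banach \<Rightarrow> 'a"
  assumes A: "bounded_linear A"
    and bound: "\<And>n x. norm ((A ^^ n) x) \<le> M * r ^ n * norm x" and r: "0 \<le> r" "r < 1"
  obtains y where "y - A y = x"
proof -
  have "summable (\<lambda>n. M * norm x * r ^ n)" using r by (intro summable_mult summable_geometric) auto
  then have summ: "summable (\<lambda>n. (A ^^ n) x)"
    by (rule summable_comparison_test'[where N = 0]) (use bound[of _ x] in \<open>auto simp: mult_ac\<close>)
  have "A (\<Sum>n. (A ^^ n) x) = (\<Sum>n. (A ^^ Suc n) x)"
    using bounded_linear.suminf[OF A summ] by simp
  also have "\<dots> = (\<Sum>n. (A ^^ n) x) - x" using suminf_split_head[OF summ] by simp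
  finally have "(\<Sum>n. (A ^^ n) x) - A (\<Sum>n. (A ^^ n) x) = x" by simp
  then show ?thesis by (rule that)
qed

text \<open>For unit \<open>y\<close> and \<open>cmod z = 1\<close> this is the signed distance of
  the point \<open>cinner (T y) y\<close> from the tangent to the unit circle at
  \<open>z\<close>.\<close>

lemma inner_pencil:
  "inner y (y - cnj z *\<^sub>C T y) = (norm y)\<^sup>2 - Re (cnj z * cinner (T y) y)"
  by (simp add: inner_diff_right power2_norm_eq_inner inner_commute[of y "cnj z *\<^sub>C T y"] inner_scaleC)

text \<open>Covers both the given operator, with \<open>M = \<rho>\<close>, and its unitary
  dilation, with \<open>M = 1\<close>.\<close>

locale power_bounded_op =
  fixes T :: "'a::complex_hilbert_space \<Rightarrow> 'a" and M :: real
  assumes clinear: "bounded_clinear T"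
    and power_bound: "norm ((T ^^ n) x) \<le> M * norm x"
begin

lemma bounded_linear: "bounded_linear T" and scaleC: "T (a *\<^sub>C x) = a *\<^sub>C T x"
  using clinear by (auto simp: bounded_clinear_def)

lemma bound: "norm (T x) \<le> M * norm x"
  using power_bound[of 1] by simp

lemma diff: "T (x - y) = T x - T y" and add: "T (x + y) = T x + T y"
    and scaleR: "T (a *\<^sub>R x) = a *\<^sub>R T x"
  by (simp_all add: bounded_linear.linear[OF bounded_linear] linear_diff linear_add linear_cmul)

lemma scaled_power: "((\<lambda>x. a *\<^sub>C T x) ^^ n) x = a ^ n *\<^sub>C (T ^^ n) x"
  by (induction n) (auto simp: scaleC scaleC_scaleC)

lemma scaled_bounded_linear: "bounded_linear (\<lambda>x. a *\<^sub>C T x)"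
  using bounded_linear_compose[OF bounded_linear_scaleC bounded_linear] .

lemma scaled_power_bound: "norm (((\<lambda>x. a *\<^sub>C T x) ^^ n) x) \<le> M * cmod a ^ n * norm x"
  unfolding scaled_power using mult_left_mono[OF power_bound, of "cmod a ^ n" n x]
  by (simp add: norm_power mult_ac)

lemma resolvent_sums:
  assumes "cmod z < 1" and "y - cnj z *\<^sub>C T y = x"
  shows "(\<lambda>n. cnj z ^ n *\<^sub>C (T ^^ n) x) sums y"
  using neumann_sums[OF scaled_bounded_linear scaled_power_bound, of "cnj z" y x] assms
  by (simp add: scaled_power)

lemma resolvent_exists:
  assumes "cmod z < 1"
  shows "\<exists>y. y - cnj z *\<^sub>C T y = x"
  using neumann_exists[OF scaled_bounded_linear scaled_power_bound, of "cnj z" x] assms by auto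

lemma cinner_resolvent_sums:
  assumes "cmod z < 1" and "y - cnj z *\<^sub>C T y = x"
  shows "(\<lambda>n. cnj z ^ n * cinner ((T ^^ n) x) v) sums cinner y v"
  using bounded_linear.sums[OF bounded_linear_cinner_left resolvent_sums[OF assms], of v]
  by (simp add: cinner_scaleC_left)

lemma resolvent_unique:
  assumes "cmod z < 1" and "y - cnj z *\<^sub>C T y = y' - cnj z *\<^sub>C T y'"
  shows "y = y'"
  using resolvent_sums[OF assms(1) refl, of y] resolvent_sums[OF assms(1) refl, of y'] assms(2)
  by (metis sums_unique2)

lemma inv_resolvent: "cmod z < 1 \<Longrightarrow> inv (\<lambda>y. y - cnj z *\<^sub>C T y) (y - cnj z *\<^sub>C T y) = y"
  by (intro inv_f_f[where f = "\<lambda>y. y - cnj z *\<^sub>C T y"] injI) (rule resolvent_unique)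

lemma resolvent_bound:
  assumes z: "cmod z < 1" and y: "y - cnj z *\<^sub>C T y = x"
  shows "norm y \<le> M / (1 - cmod z) * norm x"
proof -
  have "norm (cnj z ^ n *\<^sub>C (T ^^ n) x) \<le> M * norm x * cmod z ^ n" for n
    using mult_left_mono[OF power_bound, of "cmod z ^ n" n x] by (simp add: norm_power mult_ac)
  moreover have "(\<lambda>n. M * norm x * cmod z ^ n) sums (M * norm x * (1 / (1 - cmod z)))"
    using z by (intro sums_mult geometric_sums) auto
  ultimately show ?thesis using norm_sums_le[OF resolvent_sums[OF z y]] by (simp add: mult_ac)
qed

text \<open>The solution is the adjoint of the resolvent \<open>R\<close>, applied to
  \<open>x\<close>; Riesz representation supplies it once \<open>R\<close> is known to be
  bounded.\<close>

lemma adjoint_resolvent_exists: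
  assumes z: "cmod z < 1"
  obtains v where "v - z *\<^sub>C cadjoint T v = x"
proof -
  have "\<forall>u. \<exists>y. y - cnj z *\<^sub>C T y = u" using resolvent_exists[OF z] by blast
  then obtain R where R: "\<And>u. R u - cnj z *\<^sub>C T (R u) = u" by metis
  have R_id: "R (u - cnj z *\<^sub>C T u) = u" for u
    using resolvent_unique[OF z, of "R (u - cnj z *\<^sub>C T u)" u] R by simp
  have "bounded_linear R"
  proof (rule bounded_linear_intro)
    show "R (u + v) = R u + R v" for u v
    proof -
      have "(R u + R v) - cnj z *\<^sub>C T (R u + R v) =
          (R u - cnj z *\<^sub>C T (R u)) + (R v - cnj z *\<^sub>C T (R v))"
        by (simp add: add scaleC_add_right)
      then have "(R u + R v) - cnj z *\<^sub>C T (R u + R v) = u + v" by (simp only: R)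
      then show ?thesis using R_id[of "R u + R v"] by simp
    qed
    show "R (r *\<^sub>R u) = r *\<^sub>R R u" for r u
    proof -
      have "r *\<^sub>R R u - cnj z *\<^sub>C T (r *\<^sub>R R u) = r *\<^sub>R u"
        using arg_cong[OF R[of u], of "(*\<^sub>R) r"] by (simp add: scaleR scaleC_scaleR scaleR_diff_right)
      then show ?thesis using R_id[of "r *\<^sub>R R u"] by simp
    qed
    show "norm (R u) \<le> norm u * (M / (1 - cmod z))" for u
      using resolvent_bound[OF z R, of u] by (simp add: mult.commute)
  qed
  from riesz_representation[OF bounded_linear_compose[OF bounded_linear_inner_left this]]
  obtain v where v: "\<And>u. inner (R u) x = inner u v" by blast
  have "inner u (v - z *\<^sub>C cadjoint T v) = inner u x" for u
  proof -
    have "cinner u (z *\<^sub>C cadjoint T v) = cinner (cnj z *\<^sub>C T u) v"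
      by (simp add: cinner_scaleC_right cinner_scaleC_left cadjoint_cinner[OF clinear])
    then have "inner u (z *\<^sub>C cadjoint T v) = inner (cnj z *\<^sub>C T u) v" by (simp flip: Re_cinner)
    then have "inner u (v - z *\<^sub>C cadjoint T v) = inner (u - cnj z *\<^sub>C T u) v"
      by (simp add: inner_simps)
    also have "\<dots> = inner u x" by (simp add: R_id flip: v)
    finally show ?thesis .
  qed
  then have "v - z *\<^sub>C cadjoint T v = x"
    by (metis inner_eq_zero_iff inner_diff_right right_minus_eq)
  then show ?thesis by (rule that)
qed

text \<open>The two resolvents in the kernel are adjoint to each other, so they have the same real
  quadratic form; hence the factor 2.\<close>

lemma inner_rho_kernel:
  assumes z: "cmod z < 1" and y: "y - cnj z *\<^sub>C T y = x"
  shows "inner (rho_kernel \<rho> z T x) x = 2 * inner y x + (\<rho> - 2) * (norm x)\<^sup>2"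
proof -
  define v where "v = inv (\<lambda>y. y - z *\<^sub>C cadjoint T y) x"
  \<comment> \<open>\<open>inv\<close> selects some preimage of \<open>x\<close>; the computation
    below applies to whichever one it is.\<close>
  have "\<exists>v. v - z *\<^sub>C cadjoint T v = x" using adjoint_resolvent_exists[OF z] by blast
  then have v: "v - z *\<^sub>C cadjoint T v = x" unfolding v_def inv_def by (rule someI_ex)
  have "cinner y (z *\<^sub>C cadjoint T v) = cinner (cnj z *\<^sub>C T y) v"
    by (simp add: cinner_scaleC_right cinner_scaleC_left cadjoint_cinner[OF clinear])
  then have "inner y (z *\<^sub>C cadjoint T v) = inner (cnj z *\<^sub>C T y) v" by (simp flip: Re_cinner)
  then have "inner y (v - z *\<^sub>C cadjoint T v) = inner (y - cnj z *\<^sub>C T y) v"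
    by (simp add: inner_simps)
  then have "inner v x = inner y x" unfolding v y by (simp only: inner_commute)
  moreover have "inv (\<lambda>y. y - cnj z *\<^sub>C T y) x = y" using inv_resolvent[OF z, of y] y by simp
  ultimately show ?thesis
    by (simp add: rho_kernel_def inner_add_left power2_norm_eq_inner flip: v_def)
qed

end

text \<open>Replaces the kernels by solutions of the resolvent equations, so that inverses and
  adjoints no longer occur.\<close>

lemma harnack_dominatedE:
  assumes "harnack_dominated \<rho> T1 T0" and "power_bounded_op T0 M0" and "power_bounded_op T1 M1"
  obtains c where "\<And>z y0 y1 x. cmod z < 1 \<Longrightarrow> y0 - cnj z *\<^sub>C T0 y0 = x \<Longrightarrow> y1 - cnj z *\<^sub>C T1 y1 = x \<Longrightarrow>
    2 * inner y1 x + (\<rho> - 2) * (norm x)\<^sup>2 \<le> c\<^sup>2 * (2 * inner y0 x + (\<rho> - 2) * (norm x)\<^sup>2)"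
proof -
  from assms(1)[unfolded harnack_dominated_def]
  obtain c where "1 \<le> c"
    and c: "\<forall>z\<in>ball 0 1. op_le (rho_kernel \<rho> z T1) (\<lambda>x. c\<^sup>2 *\<^sub>R rho_kernel \<rho> z T0 x)"
    by (elim exE conjE)
  show ?thesis
  proof (rule that)
    fix z y0 y1 x
    assume z: "cmod z < 1" and y0: "y0 - cnj z *\<^sub>C T0 y0 = x" and y1: "y1 - cnj z *\<^sub>C T1 y1 = x"
    have "0 \<le> inner (c\<^sup>2 *\<^sub>R rho_kernel \<rho> z T0 x - rho_kernel \<rho> z T1 x) x"
      using c z by (auto simp: op_le_def complex_nonneg_Reals_iff Re_cinner)
    then show "2 * inner y1 x + (\<rho> - 2) * (norm x)\<^sup>2 \<le> c\<^sup>2 * (2 * inner y0 x + (\<rho> - 2) * (norm x)\<^sup>2)"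
      using power_bounded_op.inner_rho_kernel[OF assms(2) z y0, of \<rho>]
        power_bounded_op.inner_rho_kernel[OF assms(3) z y1, of \<rho>] by (simp add: inner_diff_left)
  qed
qed

subsection \<open>Positivity of the kernel\<close>

text \<open>\<open>positive\<close> is positivity of the kernel at
  \<open>x = y - cnj z *\<^sub>C T y\<close>. Written in terms of \<open>y\<close>, it also makes
  sense on the unit circle, where the resolvent may fail to exist.\<close>

locale rho_contraction = power_bounded_op T \<rho> for T :: "'a::complex_hilbert_space \<Rightarrow> 'a" and \<rho> +
  assumes rho_le: "1 \<le> \<rho>" "\<rho> \<le> 2"
    and positive: "cmod z \<le> 1 \<Longrightarrow>
      (2 - \<rho>) * (norm (y - cnj z *\<^sub>C T y))\<^sup>2 \<le> 2 * inner y (y - cnj z *\<^sub>C T y)"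

text \<open>
  With \<open>w - cnj z U w = J x\<close>, the kernel form at \<open>x\<close> is \<open>\<rho> (2 Re \<langle>w, J x\<rangle> - \<parallel>J x\<parallel>\<^sup>2) = \<rho> (\<parallel>w\<parallel>\<^sup>2 - \<bar>z\<bar>\<^sup>2 \<parallel>U w\<parallel>\<^sup>2)\<close>.
\<close>

lemma C_rho_imp_rho_contraction:
  assumes T: "T \<in> C_rho TYPE('k::complex_hilbert_space) \<rho>" and \<rho>: "1 \<le> \<rho>" "\<rho> \<le> 2"
  shows "rho_contraction T \<rho>"
proof -
  from T have TL: "bounded_clinear T"
    and "\<exists>(J :: 'a \<Rightarrow> 'k) U. unitary_rho_dilation \<rho> T J U"
    unfolding C_rho_def by simp_all
  then obtain J :: "'a \<Rightarrow> 'k" and U where "unitary_rho_dilation \<rho> T J U" by (elim exE)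
  then have J: "isometric_embedding J" and U: "unitary_op U"
    and dil: "\<And>n x. 1 \<le> n \<Longrightarrow> J ((T ^^ n) x) = \<rho> *\<^sub>R orth_proj (range J) ((U ^^ n) (J x))"
    unfolding unitary_rho_dilation_def by simp_all
  from J have iso: "cinner (J x) (J y) = cinner x y" for x y by (simp add: isometric_embedding_def)
  have nJ: "norm (J x) = norm x" for x
    using iso[of x x] by (simp add: cinner_self del: of_real_power)
  from U have UL: "bounded_clinear U" and UU: "cadjoint U (U v) = v" for v
    by (auto simp: unitary_op_def fun_eq_iff)
  have nU: "norm (U v) = norm v" for v
    using cadjoint_cinner[OF UL, of v "U v"] by (simp add: UU cinner_self del: of_real_power)
  have nUn: "norm ((U ^^ n) v) = norm v" for n v by (induction n) (auto simp: nU)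
  have compress: "cinner ((T ^^ n) x) y = \<rho> * cinner ((U ^^ n) (J x)) (J y)" if "1 \<le> n" for n x y
  proof -
    have "cinner ((T ^^ n) x) y = cinner (\<rho> *\<^sub>R orth_proj (range J) ((U ^^ n) (J x))) (J y)"
      using dil[OF that, of x] iso by metis
    also have "\<dots> = \<rho> * cinner (orth_proj (range J) ((U ^^ n) (J x))) (J y)"
      using cinner_scaleC_left[of "complex_of_real \<rho>"] by (simp only: scaleC_of_real)
    finally show ?thesis by (simp add: orth_proj_range[OF J])
  qed
  \<comment> \<open>For \<open>n \<ge> 1\<close> the dilation identity is paired with
    \<open>(T ^^ n) x\<close> itself; \<open>n = 0\<close> rests on
    \<open>1 \<le> \<rho>\<close>.\<close>
  have Tn: "norm ((T ^^ n) x) \<le> \<rho> * norm x" for n x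
  proof (cases "n = 0")
    case True
    with \<rho> show ?thesis using mult_right_mono[of 1 \<rho> "norm x"] by simp
  next
    case False
    let ?t = "(T ^^ n) x"
    have "complex_of_real ((norm ?t)\<^sup>2) = \<rho> * cinner ((U ^^ n) (J x)) (J ?t)"
      using compress[of n x ?t] False by (simp add: cinner_self)
    from arg_cong[OF this, of Re] have "(norm ?t)\<^sup>2 = \<rho> * inner ((U ^^ n) (J x)) (J ?t)"
      by (simp add: Re_cinner del: of_real_power)
    also have "\<dots> \<le> \<rho> * (norm x * norm ?t)"
      using norm_cauchy_schwarz[of "(U ^^ n) (J x)" "J ?t"] \<rho> by (intro mult_left_mono) (auto simp: nJ nUn)
    finally have "norm ?t * norm ?t \<le> (\<rho> * norm x) * norm ?t" by (simp add: power2_eq_square mult_ac)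
    then show ?thesis using \<rho> by (cases "norm ?t = 0") auto
  qed
  interpret T: power_bounded_op T \<rho> by standard (rule TL Tn)+
  interpret U: power_bounded_op U 1 by standard (auto simp: UL nUn)
  have pos: "(2 - \<rho>) * (norm (y - cnj z *\<^sub>C T y))\<^sup>2 \<le> 2 * inner y (y - cnj z *\<^sub>C T y)"
    if z: "cmod z < 1" for z y
  proof -
    define x where "x = y - cnj z *\<^sub>C T y"
    obtain w where w: "w - cnj z *\<^sub>C U w = J x" using U.resolvent_exists[OF z] by blast
    let ?t = "\<lambda>n. cnj z ^ n * cinner ((T ^^ n) x) x"
    let ?u = "\<lambda>n. cnj z ^ n * cinner ((U ^^ n) (J x)) (J x)"
    have t: "?t sums cinner y x" using T.cinner_resolvent_sums[OF z] x_def by blast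
    have u: "?u sums cinner w (J x)" using U.cinner_resolvent_sums[OF z w] .
    \<comment> \<open>The dilation identity starts at \<open>n = 1\<close>, so the zeroth terms,
      both equal to \<open>cinner x x\<close>, are split off.\<close>
    have t': "(\<lambda>n. ?t (Suc n)) sums (cinner y x - cinner x x)" using sums_Suc_iff[of ?t] t by simp
    have "(\<lambda>n. ?u (Suc n)) sums (cinner w (J x) - cinner x x)"
      using sums_Suc_iff[of ?u] u by (simp add: iso)
    then have u': "(\<lambda>n. \<rho> * ?u (Suc n)) sums (\<rho> * (cinner w (J x) - cinner x x))" by (rule sums_mult)
    have "\<rho> * ?u (Suc n) = ?t (Suc n)" for n using compress[of "Suc n" x x] by simp
    with u' have "(\<lambda>n. ?t (Suc n)) sums (\<rho> * (cinner w (J x) - cinner x x))" by (simp only:)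
    with t' have "cinner y x - cinner x x = \<rho> * (cinner w (J x) - cinner x x)" by (rule sums_unique2)
    then have "inner y x - (norm x)\<^sup>2 = \<rho> * (inner w (J x) - (norm x)\<^sup>2)"
      by (simp add: complex_eq_iff Re_cinner power2_norm_eq_inner)
    \<comment> \<open>\<open>w - J x\<close> equals \<open>cnj z *\<^sub>C U w\<close>, which is no
      longer than \<open>w\<close>; expanding the squares gives the bound.\<close>
    moreover have "(norm x)\<^sup>2 \<le> 2 * inner w (J x)"
    proof -
      have "cmod z * norm w \<le> 1 * norm w" using z by (intro mult_right_mono) auto
      then have "(norm (w - J x))\<^sup>2 \<le> (norm w)\<^sup>2"
        by (intro power_mono) (simp_all add: nU flip: w)
      then show ?thesis by (simp add: power2_norm_eq_inner inner_simps inner_commute iso nJ[unfolded norm_eq])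
    qed
    then have "\<rho> * (norm x)\<^sup>2 \<le> \<rho> * (2 * inner w (J x))" using \<rho> by (intro mult_left_mono) auto
    ultimately show ?thesis
      unfolding x_def[symmetric] left_diff_distrib right_diff_distrib by linarith
  qed
  \<comment> \<open>The unit circle is reached by a radial limit from inside the disc.\<close>
  have "(2 - \<rho>) * (norm (y - cnj z *\<^sub>C T y))\<^sup>2 \<le> 2 * inner y (y - cnj z *\<^sub>C T y)"
    if z: "cmod z \<le> 1" for z y
  proof (rule tendsto_le)
    have lim: "((\<lambda>t. y - cnj (complex_of_real t * z) *\<^sub>C T y) \<longlongrightarrow> y - cnj (complex_of_real 1 * z) *\<^sub>C T y) (at_left 1)"
    proof -
      have "((\<lambda>t. y - t *\<^sub>R (cnj z *\<^sub>C T y)) \<longlongrightarrow> y - 1 *\<^sub>R (cnj z *\<^sub>C T y)) (at_left 1)"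
        by (intro tendsto_intros)
      then show ?thesis by (simp add: scaleC_of_real flip: scaleC_scaleC)
    qed
    show "((\<lambda>t. 2 * inner y (y - cnj (complex_of_real t * z) *\<^sub>C T y)) \<longlongrightarrow> 2 * inner y (y - cnj z *\<^sub>C T y)) (at_left 1)"
      using lim by (auto intro!: tendsto_intros)
    show "((\<lambda>t. (2 - \<rho>) * (norm (y - cnj (complex_of_real t * z) *\<^sub>C T y))\<^sup>2) \<longlongrightarrow> (2 - \<rho>) * (norm (y - cnj z *\<^sub>C T y))\<^sup>2) (at_left 1)"
      using lim by (auto intro!: tendsto_intros)
    have "\<forall>\<^sub>F t in at_left 1. t \<in> {0<..<1::real}" by (rule eventually_at_leftI[of 0]) auto
    then show "\<forall>\<^sub>F t in at_left 1. (2 - \<rho>) * (norm (y - cnj (complex_of_real t * z) *\<^sub>C T y))\<^sup>2 \<le>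
        2 * inner y (y - cnj (complex_of_real t * z) *\<^sub>C T y)"
    proof eventually_elim
      case (elim t)
      then have "t * cmod z \<le> t * 1" using z by (intro mult_left_mono) auto
      also have "\<dots> < 1" using elim by simp
      finally have "t * cmod z < 1" .
      then show ?case using elim by (intro pos) (simp add: norm_mult)
    qed
  qed simp
  with \<rho> show ?thesis by unfold_locales auto
qed

subsection \<open>Caratheodory's coefficient bound\<close>

text \<open>The Cayley transform turns this into the Schwarz lemma.\<close>

lemma caratheodory_first_coefficient:
  fixes F :: "complex \<Rightarrow> complex"
  assumes F: "\<And>w. cmod w < 1 \<Longrightarrow> (\<lambda>n. a n * w ^ n) sums F w"
    and Re_F: "\<And>w. cmod w < 1 \<Longrightarrow> 0 \<le> Re (F w)"
    and a0: "a 0 = complex_of_real \<alpha>"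
  shows "cmod (a 1) \<le> 2 * \<alpha>"
proof (rule field_le_epsilon)
  \<comment> \<open>The slack \<open>e\<close> gives \<open>F w + \<alpha> + e\<close> positive real
    part, even when \<open>\<alpha> = 0\<close>.\<close>
  fix e :: real assume e: "0 < e"
  define b where "b = \<alpha> + e / 2"
  have F0: "F 0 = \<alpha>" using sums_unique2[OF F[of 0] powser_sums_zero[of a]] a0 by simp
  have b: "0 < b" using Re_F[of 0] e by (simp add: F0 b_def)
  have denom: "F w + \<alpha> + e \<noteq> 0" if "cmod w < 1" for w
    using Re_F[OF that] Re_F[of 0] e by (auto simp: F0 complex_eq_iff)
  \<comment> \<open>\<open>G\<close> fixes 0, maps the disc into itself and has derivative
    \<open>a 1 / (2 * \<alpha> + e)\<close> at 0, whose modulus the Schwarz lemma bounds by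
    1.\<close>
  define G where "G = (\<lambda>w. (F w - \<alpha>) / (F w + \<alpha> + e))"
  have "F holomorphic_on ball 0 1" using F by (intro power_series_holomorphic[where a = a]) auto
  then have "G holomorphic_on ball 0 1"
    unfolding G_def using denom by (intro holomorphic_intros) auto
  moreover have "G 0 = 0" by (simp add: G_def F0)
  moreover have "cmod (G w) < 1" if w: "cmod w < 1" for w
  proof -
    have "(cmod (F w - \<alpha>))\<^sup>2 < (cmod (F w + \<alpha> + e))\<^sup>2"
    proof -
      have "0 \<le> (2 * Re (F w) + e) * \<alpha>" using Re_F[OF w] Re_F[of 0] e F0 by simp
      moreover have "0 < e * (2 * Re (F w) + e)" using Re_F[OF w] e by simp
      moreover have "0 \<le> Re (F w) * \<alpha>" "0 \<le> e * \<alpha>" using Re_F[OF w] Re_F[of 0] e F0 by simp_all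
      ultimately show ?thesis
        unfolding cmod_power2 by (simp add: power2_eq_square algebra_simps)
    qed
    then have "cmod (F w - \<alpha>) < cmod (F w + \<alpha> + e)" by (rule power_less_imp_less_base) simp
    then show ?thesis using denom[OF w] by (simp add: G_def norm_divide)
  qed
  ultimately have "cmod (deriv G 0) \<le> 1" by (intro Schwarz_Lemma(2)[where \<xi> = 0]) auto
  moreover have "(G has_field_derivative a 1 / (2 * b)) (at 0)"
  proof -
    have "((\<lambda>w. \<Sum>n. a n * w ^ n) has_field_derivative (\<Sum>n. diffs a n * 0 ^ n)) (at 0)"
      using F by (intro termdiffs_strong'[where K = 1]) (auto simp: sums_iff)
    then have "((\<lambda>w. \<Sum>n. a n * w ^ n) has_field_derivative a 1) (at 0)"
      by (simp add: powser_zero diffs_def)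
    then have F': "(F has_field_derivative a 1) (at 0)"
      by (rule has_field_derivative_transform_within_open[of _ _ _ "ball 0 1"])
        (use F in \<open>auto simp: sums_iff\<close>)
    have nz: "2 * complex_of_real \<alpha> + e = 2 * complex_of_real b" by (simp add: b_def)
    have b': "complex_of_real b \<noteq> 0" using b by simp
    have "(G has_field_derivative
        (a 1 * (F 0 + \<alpha> + e) - (F 0 - \<alpha>) * a 1) / ((F 0 + \<alpha> + e) * (F 0 + \<alpha> + e))) (at 0)"
      unfolding G_def using denom[of 0] by (auto intro!: derivative_eq_intros F')
    moreover have "(a 1 * (F 0 + \<alpha> + e) - (F 0 - \<alpha>) * a 1) / ((F 0 + \<alpha> + e) * (F 0 + \<alpha> + e)) = a 1 / (2 * b)"
      using denom[of 0] nz b' by (simp add: F0)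
    ultimately show ?thesis by simp
  qed
  then have "deriv G 0 = a 1 / (2 * b)" by (rule DERIV_imp_deriv)
  ultimately have "cmod (a 1) \<le> 2 * b" using b by (simp add: norm_divide divide_le_eq)
  then show "cmod (a 1) \<le> 2 * \<alpha> + e" by (simp add: b_def)
qed

subsection \<open>Numerical range and approximate eigenvalues on the unit circle\<close>

text \<open>On the unit circle \<open>norm (y - cnj \<mu> *\<^sub>C T y) = norm (T y - \<mu>
  *\<^sub>C y)\<close>, so this is the usual notion there, phrased to match the kernel.\<close>

definition approx_eigenvalue :: "('a::complex_hilbert_space \<Rightarrow> 'a) \<Rightarrow> complex \<Rightarrow> bool" where
  "approx_eigenvalue T \<mu> \<longleftrightarrow> (\<forall>\<epsilon>>0. \<exists>y. norm y = 1 \<and> norm (y - cnj \<mu> *\<^sub>C T y) < \<epsilon>)"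

lemma (in power_bounded_op) not_approx_eigenvalue_imp_bounded_below:
  assumes "\<not> approx_eigenvalue T \<mu>"
  obtains \<delta> where "0 < \<delta>" and "\<And>y. \<delta> * norm y \<le> norm (y - cnj \<mu> *\<^sub>C T y)"
proof -
  from assms obtain \<delta> where \<delta>: "0 < \<delta>" "\<And>y. norm y = 1 \<Longrightarrow> \<delta> \<le> norm (y - cnj \<mu> *\<^sub>C T y)"
    by (force simp: approx_eigenvalue_def)
  have "\<delta> * norm y \<le> norm (y - cnj \<mu> *\<^sub>C T y)" for y
  proof (cases "y = 0")
    case False
    define u where "u = (1 / norm y) *\<^sub>R y"
    have "u - cnj \<mu> *\<^sub>C T u = (1 / norm y) *\<^sub>R (y - cnj \<mu> *\<^sub>C T y)"
      by (simp add: u_def scaleR scaleC_scaleR scaleR_diff_right)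
    then have "norm (u - cnj \<mu> *\<^sub>C T u) = norm (y - cnj \<mu> *\<^sub>C T y) / norm y" by simp
    moreover have "\<delta> \<le> norm (u - cnj \<mu> *\<^sub>C T u)" using False by (intro \<delta>(2)) (simp add: u_def)
    ultimately show ?thesis using False by (simp add: pos_le_divide_eq)
  qed simp
  with \<delta>(1) that show ?thesis by blast
qed

text \<open>A bounded inverse would bound \<open>norm y\<close> by a multiple of
  \<open>norm (T y - \<mu> *\<^sub>C y)\<close>, which is arbitrarily small on unit vectors.\<close>

lemma approx_eigenvalue_imp_peripheral_spectrum:
  assumes T: "power_bounded_op T M" and \<mu>: "cmod \<mu> = 1" and ap: "approx_eigenvalue T \<mu>"
  shows "\<mu> \<in> peripheral_spectrum T"
proof -
  have False if S: "bounded_clinear S" "S \<circ> (\<lambda>x. T x - \<mu> *\<^sub>C x) = id" for S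
  proof -
    obtain K where K: "0 < K" "\<And>x. norm (S x) \<le> norm x * K"
      using S(1) bounded_linear.pos_bounded unfolding bounded_clinear_def by blast
    obtain y where y: "norm y = 1" "norm (y - cnj \<mu> *\<^sub>C T y) < 1 / K"
      using ap K(1) unfolding approx_eigenvalue_def by (meson zero_less_divide_1_iff)
    have "\<mu> *\<^sub>C (y - cnj \<mu> *\<^sub>C T y) = \<mu> *\<^sub>C y - T y"
      using \<mu> by (simp add: scaleC_diff_right scaleC_scaleC complex_norm_square[symmetric])
    then have "norm (y - cnj \<mu> *\<^sub>C T y) = norm (T y - \<mu> *\<^sub>C y)"
      using \<mu> by (metis mult_1 norm_minus_commute norm_scaleC)
    moreover have "norm y \<le> norm (T y - \<mu> *\<^sub>C y) * K"
      using K(2)[of "T y - \<mu> *\<^sub>C y"] fun_cong[OF S(2), of y] by simp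
    ultimately show False using y K(1) by (simp add: field_simps)
  qed
  then show ?thesis using \<mu> by (auto simp: peripheral_spectrum_def op_spectrum_def)
qed

context rho_contraction
begin

lemma radial_pencil:
  "y - cnj (complex_of_real (1 - s) * \<mu>) *\<^sub>C T y = (y - cnj \<mu> *\<^sub>C T y) + s *\<^sub>R (cnj \<mu> *\<^sub>C T y)"
proof -
  have "cnj (complex_of_real (1 - s) * \<mu>) *\<^sub>C T y = (1 - s) *\<^sub>R (cnj \<mu> *\<^sub>C T y)"
    by (simp flip: scaleC_of_real scaleC_scaleC)
  then show ?thesis by (simp add: algebra_simps)
qed

text \<open>Moving from \<open>\<mu>\<close> to \<open>(1 - s) \<mu>\<close> perturbs the pencil by
  at most \<open>s * \<rho> * norm y\<close>, which costs at most half of the lower bound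
  \<open>\<delta>\<close>. The resulting constant does not depend on \<open>s\<close>.\<close>

lemma radial_resolvent_bound:
  assumes "cmod \<mu> = 1" and \<delta>: "0 < \<delta>" "\<And>y. \<delta> * norm y \<le> norm (y - cnj \<mu> *\<^sub>C T y)"
    and s: "0 \<le> s" "s * \<rho> \<le> \<delta> / 2"
  shows "norm y \<le> 2 / \<delta> * norm (y - cnj (complex_of_real (1 - s) * \<mu>) *\<^sub>C T y)"
proof -
  have "y - cnj \<mu> *\<^sub>C T y = (y - cnj (complex_of_real (1 - s) * \<mu>) *\<^sub>C T y) - s *\<^sub>R (cnj \<mu> *\<^sub>C T y)"
    unfolding radial_pencil by simp
  then have "norm (y - cnj \<mu> *\<^sub>C T y) \<le>
      norm (y - cnj (complex_of_real (1 - s) * \<mu>) *\<^sub>C T y) + norm (s *\<^sub>R (cnj \<mu> *\<^sub>C T y))"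
    by (simp only: norm_triangle_ineq4)
  also have "norm (s *\<^sub>R (cnj \<mu> *\<^sub>C T y)) = s * norm (T y)" using assms(1) s(1) by simp
  finally have "\<delta> * norm y \<le> norm (y - cnj (complex_of_real (1 - s) * \<mu>) *\<^sub>C T y) + s * norm (T y)"
    by (rule order_trans[OF \<delta>(2)])
  moreover have "s * norm (T y) \<le> s * (\<rho> * norm y)" using s(1) bound[of y] by (intro mult_left_mono)
  moreover have "(s * \<rho>) * norm y \<le> \<delta> / 2 * norm y" using s(2) by (rule mult_right_mono) simp
  ultimately show ?thesis using \<delta>(1) by (simp add: field_simps)
qed

text \<open>Positivity is applied in the direction \<open>z = sgn w\<close>, which rotates
  \<open>w\<close> onto its modulus; for \<open>w = 0\<close> it reads \<open>z = 0\<close>, still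
  in the closed disc.\<close>

lemma numerical_range_bound:
  assumes "norm y = 1"
  shows "cmod (cinner (T y) y) \<le> 1"
proof -
  define w where "w = cinner (T y) y"
  define z where "z = sgn w"
  have "0 \<le> (2 - \<rho>) * (norm (y - cnj z *\<^sub>C T y))\<^sup>2" using rho_le by simp
  also have "\<dots> \<le> 2 * inner y (y - cnj z *\<^sub>C T y)" by (rule positive) (simp add: z_def norm_sgn)
  finally have "Re (cnj z * w) \<le> 1" using assms by (simp add: inner_pencil w_def)
  moreover have "cnj z * w = complex_of_real (cmod w)"
  proof (cases "w = 0")
    case False
    have "cnj w * w = complex_of_real ((cmod w)\<^sup>2)" by (metis complex_norm_square mult.commute)
    with False show ?thesis by (simp add: z_def sgn_eq power2_eq_square)
  qed simp
  ultimately have "Re (complex_of_real (cmod w)) \<le> 1" by (simp only:)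
  then show ?thesis by (simp add: w_def)
qed

text \<open>In the closed disc, a point near the tangent at \<open>\<mu>\<close> is near
  \<open>\<mu>\<close>: if \<open>cmod w \<le> 1\<close>, then the square of
  \<open>cmod (w - \<mu>)\<close> is at most \<open>2 * (1 - Re (cnj \<mu> * w))\<close>.\<close>

lemma closure_numerical_range_iff:
  assumes \<mu>: "cmod \<mu> = 1"
  shows "\<mu> \<in> closure (numerical_range T) \<longleftrightarrow>
    (\<forall>\<epsilon>>0. \<exists>y. norm y = 1 \<and> inner y (y - cnj \<mu> *\<^sub>C T y) < \<epsilon>)"
proof
  assume cl: "\<mu> \<in> closure (numerical_range T)"
  show "\<forall>\<epsilon>>0. \<exists>y. norm y = 1 \<and> inner y (y - cnj \<mu> *\<^sub>C T y) < \<epsilon>"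
  proof (intro allI impI)
    fix \<epsilon> :: real assume "0 < \<epsilon>"
    then obtain y where y: "norm y = 1" "dist (cinner (T y) y) \<mu> < \<epsilon>"
      using cl by (auto simp: closure_approachable numerical_range_def)
    have "1 - Re (cnj \<mu> * cinner (T y) y) = Re (cnj \<mu> * (\<mu> - cinner (T y) y))"
      using \<mu> by (simp add: right_diff_distrib mult.commute[of "cnj \<mu>" \<mu>] flip: complex_norm_square)
    also have "\<dots> \<le> cmod (cnj \<mu> * (\<mu> - cinner (T y) y))" by (rule complex_Re_le_cmod)
    also have "\<dots> < \<epsilon>" using y(2) \<mu> by (simp add: norm_mult dist_norm norm_minus_commute)
    finally show "\<exists>y. norm y = 1 \<and> inner y (y - cnj \<mu> *\<^sub>C T y) < \<epsilon>"
      using y(1) by (auto simp: inner_pencil)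
  qed
next
  assume approx: "\<forall>\<epsilon>>0. \<exists>y. norm y = 1 \<and> inner y (y - cnj \<mu> *\<^sub>C T y) < \<epsilon>"
  show "\<mu> \<in> closure (numerical_range T)"
    unfolding closure_approachable
  proof (intro allI impI)
    fix e :: real assume e: "0 < e"
    then obtain y where y: "norm y = 1" "inner y (y - cnj \<mu> *\<^sub>C T y) < e\<^sup>2 / 2"
      using approx[rule_format, of "e\<^sup>2 / 2"] by auto
    define w where "w = cinner (T y) y"
    have "(cmod (w - \<mu>))\<^sup>2 = (cmod w)\<^sup>2 + (cmod \<mu>)\<^sup>2 - 2 * Re (cnj \<mu> * w)"
      unfolding cmod_power2 by (simp add: power2_eq_square algebra_simps)
    also have "\<dots> \<le> 2 * (1 - Re (cnj \<mu> * w))"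
      using numerical_range_bound[OF y(1)] \<mu> by (simp add: w_def power_le_one)
    also have "\<dots> < e\<^sup>2" using y by (simp add: inner_pencil w_def)
    finally have "dist w \<mu> < e" using e by (simp add: dist_norm power_less_imp_less_base)
    then show "\<exists>w\<in>numerical_range T. dist w \<mu> < e" using y(1) by (auto simp: numerical_range_def w_def)
  qed
qed

lemma approx_eigenvalue_imp_closure_numerical_range:
  assumes \<mu>: "cmod \<mu> = 1" and "approx_eigenvalue T \<mu>"
  shows "\<mu> \<in> closure (numerical_range T)"
  unfolding closure_numerical_range_iff[OF \<mu>]
proof (intro allI impI)
  fix \<epsilon> :: real assume "0 < \<epsilon>"
  then obtain y where y: "norm y = 1" "norm (y - cnj \<mu> *\<^sub>C T y) < \<epsilon>"
    using assms(2) by (auto simp: approx_eigenvalue_def)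
  then show "\<exists>y. norm y = 1 \<and> inner y (y - cnj \<mu> *\<^sub>C T y) < \<epsilon>"
    using norm_cauchy_schwarz[of y "y - cnj \<mu> *\<^sub>C T y"] by (intro exI[of _ y]) auto
qed

text \<open>Positivity at \<open>\<mu>\<close> bounds \<open>(2 - \<rho>)\<close> times the squared
  norm of the pencil by twice its form, which is small here. For \<open>\<rho> = 2\<close> it says
  nothing about that norm.\<close>

lemma closure_numerical_range_imp_approx_eigenvalue:
  assumes \<mu>: "cmod \<mu> = 1" and "\<rho> < 2" and cl: "\<mu> \<in> closure (numerical_range T)"
  shows "approx_eigenvalue T \<mu>"
  unfolding approx_eigenvalue_def
proof (intro allI impI)
  fix \<epsilon> :: real assume \<epsilon>: "0 < \<epsilon>"
  then have "0 < (2 - \<rho>) * \<epsilon>\<^sup>2 / 2" using assms(2) by simp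
  with cl obtain y where y: "norm y = 1" "inner y (y - cnj \<mu> *\<^sub>C T y) < (2 - \<rho>) * \<epsilon>\<^sup>2 / 2"
    unfolding closure_numerical_range_iff[OF \<mu>] by blast
  have "(2 - \<rho>) * (norm (y - cnj \<mu> *\<^sub>C T y))\<^sup>2 < (2 - \<rho>) * \<epsilon>\<^sup>2"
    using positive[of \<mu> y] y(2) \<mu> by simp
  then have "norm (y - cnj \<mu> *\<^sub>C T y) < \<epsilon>"
    using assms(2) \<epsilon> by (simp add: power_less_imp_less_base)
  with y(1) show "\<exists>y. norm y = 1 \<and> norm (y - cnj \<mu> *\<^sub>C T y) < \<epsilon>" by blast
qed

end

subsection \<open>Transfer under Harnack domination\<close>

text \<open>The dominating operator \<open>T0\<close> comes first, in contrast to the argument order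
  of \<open>harnack_dominated\<close>.\<close>

locale harnack_pair = T0: rho_contraction T0 \<rho> + T1: rho_contraction T1 \<rho>
  for T0 T1 :: "'a::complex_hilbert_space \<Rightarrow> 'a" and \<rho> +
  fixes c :: real
  assumes harnack: "cmod z < 1 \<Longrightarrow> y0 - cnj z *\<^sub>C T0 y0 = x \<Longrightarrow> y1 - cnj z *\<^sub>C T1 y1 = x \<Longrightarrow>
    2 * inner y1 x + (\<rho> - 2) * (norm x)\<^sup>2 \<le> c\<^sup>2 * (2 * inner y0 x + (\<rho> - 2) * (norm x)\<^sup>2)"
begin

text \<open>
  At \<open>(1 - s) \<mu>\<close> the kernel of \<open>T1\<close> is of order \<open>1 / s\<close> on an approximate eigenvector, whereas
  that of \<open>T0\<close> stays bounded as \<open>s \<rightarrow> 0\<close> if \<open>T0\<close> has no approximate eigenvalue at \<open>\<mu>\<close>.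
\<close>

lemma approx_eigenvalue_transfer:
  assumes \<mu>: "cmod \<mu> = 1" and ap: "approx_eigenvalue T1 \<mu>"
  shows "approx_eigenvalue T0 \<mu>"
proof (rule ccontr)
  assume "\<not> approx_eigenvalue T0 \<mu>"
  then obtain \<delta> where \<delta>: "0 < \<delta>" "\<And>y. \<delta> * norm y \<le> norm (y - cnj \<mu> *\<^sub>C T0 y)"
    using T0.not_approx_eigenvalue_imp_bounded_below by blast
  \<comment> \<open>The first summand comes from the bounded resolvent of \<open>T0\<close>, the 1
    from \<open>2 - \<rho> \<le> 1\<close>; the goal is
    \<open>s \<le> K * (norm x)\<^sup>2\<close>.\<close>
  define K where "K = 4 * c\<^sup>2 / \<delta> + 1"
  have K: "1 \<le> K" using \<delta> by (simp add: K_def)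
  \<comment> \<open>The first bound makes the radial resolvent estimate for \<open>T0\<close>
    available. The second contradicts \<open>s \<le> K * (3 / 2 * s)\<^sup>2\<close>, whose right
    side is then at most \<open>3 / 4 * s\<close>.\<close>
  define s where "s = min (\<delta> / (2 * \<rho>)) (1 / (3 * K))"
  have s: "0 < s" using \<delta> T0.rho_le K by (simp add: s_def)
  have s_le: "s * \<rho> \<le> \<delta> / 2" using T0.rho_le by (simp add: s_def min_def field_simps)
  have sK: "s * K \<le> 1 / 3" using K by (simp add: s_def min_def field_simps)
  have "s * 1 \<le> s * K" using K s by (intro mult_left_mono) auto
  with sK have s1: "s < 1" by linarith
  define z where "z = complex_of_real (1 - s) * \<mu>"
  have z: "cmod z < 1" unfolding z_def norm_mult norm_of_real using s s1 \<mu> by simp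
  obtain y1 where y1: "norm y1 = 1" "norm (y1 - cnj \<mu> *\<^sub>C T1 y1) < s / 2"
    using ap s unfolding approx_eigenvalue_def by (meson half_gt_zero)
  define x where "x = y1 - cnj z *\<^sub>C T1 y1"
  define d where "d = y1 - cnj \<mu> *\<^sub>C T1 y1"
  \<comment> \<open>So \<open>x\<close> is \<open>s *\<^sub>R y1\<close> up to an error below
    \<open>s / 2\<close>: both \<open>norm x\<close> and \<open>inner y1 x\<close> are of order
    \<open>s\<close>.\<close>
  have "x = s *\<^sub>R y1 + (1 - s) *\<^sub>R d"
    using T1.radial_pencil[of y1 s \<mu>] by (simp add: x_def z_def d_def algebra_simps)
  moreover have "norm ((1 - s) *\<^sub>R d) \<le> norm d" using s s1 mult_right_mono[of "1 - s" 1 "norm d"] by simp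
  ultimately have xd: "norm (x - s *\<^sub>R y1) < s / 2" using y1(2) by (simp add: d_def)
  have nx: "norm x \<le> 3 / 2 * s"
    using norm_triangle_ineq[of "s *\<^sub>R y1" "x - s *\<^sub>R y1"] xd y1(1) s by simp
  have "inner y1 (x - s *\<^sub>R y1) = inner y1 x - s" using y1(1) by (simp add: inner_diff_right norm_eq_1)
  moreover have "- inner y1 (x - s *\<^sub>R y1) \<le> norm (x - s *\<^sub>R y1)"
    using norm_cauchy_schwarz[of "- y1" "x - s *\<^sub>R y1"] y1(1) by simp
  ultimately have lower: "s / 2 \<le> inner y1 x" using xd by simp
  obtain y0 where y0: "y0 - cnj z *\<^sub>C T0 y0 = x" using T0.resolvent_exists[OF z] by blast
  have ny0: "norm y0 \<le> 2 / \<delta> * norm x"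
    using T0.radial_resolvent_bound[OF \<mu> \<delta> less_imp_le[OF s] s_le, of y0] y0 by (simp add: z_def)
  have N: "0 \<le> (2 - \<rho>) * (norm x)\<^sup>2" "(2 - \<rho>) * (norm x)\<^sup>2 \<le> 1 * (norm x)\<^sup>2"
    using T0.rho_le by (simp, intro mult_right_mono) auto
  have "inner y0 x \<le> norm y0 * norm x" by (rule norm_cauchy_schwarz)
  also have "\<dots> \<le> 2 / \<delta> * norm x * norm x" using ny0 by (rule mult_right_mono) simp
  finally have "inner y0 x \<le> 2 / \<delta> * (norm x)\<^sup>2" by (simp only: power2_eq_square mult.assoc)
  with N(1) have "2 * inner y0 x + (\<rho> - 2) * (norm x)\<^sup>2 \<le> 2 * (2 / \<delta> * (norm x)\<^sup>2)"
    unfolding left_diff_distrib by linarith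
  also have "\<dots> = 4 / \<delta> * (norm x)\<^sup>2" by simp
  finally have "c\<^sup>2 * (2 * inner y0 x + (\<rho> - 2) * (norm x)\<^sup>2) \<le> c\<^sup>2 * (4 / \<delta> * (norm x)\<^sup>2)"
    by (rule mult_left_mono) simp
  moreover have "2 * inner y1 x + (\<rho> - 2) * (norm x)\<^sup>2 \<le> c\<^sup>2 * (2 * inner y0 x + (\<rho> - 2) * (norm x)\<^sup>2)"
    by (rule harnack[OF z y0]) (simp add: x_def)
  ultimately have "s \<le> c\<^sup>2 * (4 / \<delta> * (norm x)\<^sup>2) + (2 - \<rho>) * (norm x)\<^sup>2"
    using lower by (simp add: algebra_simps)
  also have "\<dots> \<le> K * (norm x)\<^sup>2" using N(2) by (simp add: K_def algebra_simps)
  also have "\<dots> \<le> K * (3 / 2 * s)\<^sup>2" using nx K by (intro mult_left_mono power_mono) auto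
  also have "\<dots> = 9 / 4 * (s * (s * K))" by (simp add: power2_eq_square)
  also have "\<dots> \<le> 9 / 4 * (s * (1 / 3))" using sK s by (intro mult_left_mono) auto
  finally show False using s by simp
qed

text \<open>
  Off the approximate point spectrum of \<open>T0\<close> the kernel inequality could be used at \<open>\<mu>\<close> itself:
  if \<open>y\<close> nearly attains \<open>\<mu>\<close> for \<open>T0\<close>, then \<open>y1\<close> with \<open>y1 - cnj \<mu> T1 y1 = y - cnj \<mu> T0 y\<close> nearly
  attains it for \<open>T1\<close>. Since that equation need not be solvable, \<open>\<mu>\<close> is replaced by \<open>(1 - s) \<mu>\<close> with small \<open>s\<close>.
\<close>

lemma closure_numerical_range_transfer:
  assumes \<mu>: "cmod \<mu> = 1" and cl: "\<mu> \<in> closure (numerical_range T0)"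
    and nap: "\<not> approx_eigenvalue T0 \<mu>"
  shows "\<mu> \<in> closure (numerical_range T1)"
  unfolding T1.closure_numerical_range_iff[OF \<mu>]
proof (intro allI impI)
  fix \<epsilon> :: real assume \<epsilon>: "0 < \<epsilon>"
  from nap obtain \<delta> where \<delta>: "0 < \<delta>" "\<And>y. \<delta> * norm y \<le> norm (y - cnj \<mu> *\<^sub>C T0 y)"
    using T0.not_approx_eigenvalue_imp_bounded_below by blast
  have \<rho>: "1 \<le> \<rho>" "\<rho> \<le> 2" using T0.rho_le by auto
  \<comment> \<open>\<open>\<kappa>\<close> will bound \<open>(norm y1)\<^sup>2\<close> from below,
    and \<open>s * L\<close> will collect the errors caused by leaving \<open>\<mu>\<close>
    radially.\<close>
  define \<kappa> where "\<kappa> = (\<delta> / (1 + \<rho>))\<^sup>2"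
  define L where "L = c\<^sup>2 * (2 / \<delta> * \<rho> * (1 + \<rho>)) + \<kappa> * \<rho>"
  have \<kappa>: "0 < \<kappa>" using \<delta> \<rho> by (simp add: \<kappa>_def)
  have L: "0 < L" using \<kappa> \<delta> \<rho> by (auto simp: L_def intro!: add_nonneg_pos)
  \<comment> \<open>Both \<open>s * L\<close> and, by the choice of \<open>y\<close>,
    \<open>(1 + c\<^sup>2) * \<eta>\<close> are at most a third of
    \<open>\<kappa> * \<epsilon>\<close>.\<close>
  define s where "s = min (1 / 2) (min (\<delta> / (2 * \<rho>)) (\<kappa> * \<epsilon> / (3 * L)))"
  have s: "0 < s" "s < 1" using \<delta> \<rho> \<kappa> L \<epsilon> by (auto simp: s_def)
  have s_le: "s * \<rho> \<le> \<delta> / 2"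
  proof -
    have "s \<le> \<delta> / (2 * \<rho>)" by (simp add: s_def)
    then show ?thesis using \<rho> by (simp add: field_simps)
  qed
  have sL: "s * L \<le> \<kappa> * \<epsilon> / 3"
  proof -
    have "s \<le> \<kappa> * \<epsilon> / (3 * L)" by (simp add: s_def)
    then show ?thesis using L by (simp add: field_simps)
  qed
  have "0 < \<kappa> * \<epsilon> / (3 * (1 + c\<^sup>2))" using \<kappa> \<epsilon> by (auto intro!: divide_pos_pos mult_pos_pos add_pos_nonneg)
  with cl obtain y where y: "norm y = 1" "inner y (y - cnj \<mu> *\<^sub>C T0 y) < \<kappa> * \<epsilon> / (3 * (1 + c\<^sup>2))"
    unfolding T0.closure_numerical_range_iff[OF \<mu>] by blast
  define x where "x = y - cnj \<mu> *\<^sub>C T0 y"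
  define \<eta> where "\<eta> = inner y x"
  have \<eta>: "(1 + c\<^sup>2) * \<eta> \<le> \<kappa> * \<epsilon> / 3"
  proof -
    have "0 < 1 + c\<^sup>2" by (simp add: add_pos_nonneg)
    then show ?thesis using y(2) by (simp add: \<eta>_def x_def field_simps)
  qed
  \<comment> \<open>Positivity of \<open>T0\<close> at \<open>\<mu>\<close> shows that the term
    \<open>(2 - \<rho>) * (norm x)\<^sup>2\<close> is itself controlled by \<open>\<eta>\<close>,
    although \<open>norm x\<close> stays above \<open>\<delta>\<close>.\<close>
  have N: "(2 - \<rho>) * (norm x)\<^sup>2 \<le> 2 * \<eta>" "0 \<le> (2 - \<rho>) * (norm x)\<^sup>2"
    using T0.positive[of \<mu> y] \<mu> \<rho> by (simp_all add: \<eta>_def x_def)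
  have x_lower: "\<delta> \<le> norm x" using \<delta>(2)[of y] y(1) by (simp add: x_def)
  have x_upper: "norm x \<le> 1 + \<rho>"
    using norm_triangle_ineq4[of y "cnj \<mu> *\<^sub>C T0 y"] T0.bound[of y] y(1) \<mu> by (simp add: x_def)
  define z where "z = complex_of_real (1 - s) * \<mu>"
  have z: "cmod z < 1" unfolding z_def norm_mult norm_of_real using s \<mu> by simp
  obtain y0 where y0: "y0 - cnj z *\<^sub>C T0 y0 = x" using T0.resolvent_exists[OF z] by blast
  obtain y1 where y1: "y1 - cnj z *\<^sub>C T1 y1 = x" using T1.resolvent_exists[OF z] by blast
  \<comment> \<open>The exact solution \<open>y0\<close> at \<open>z\<close> and the vector
    \<open>y\<close> chosen at \<open>\<mu>\<close> differ by order \<open>s\<close>, because their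
    difference solves an equation with right side of order \<open>s\<close>.\<close>
  have "(y0 - y) - cnj z *\<^sub>C T0 (y0 - y) = x - (y - cnj z *\<^sub>C T0 y)"
    using y0 by (simp add: T0.diff scaleC_diff_right algebra_simps)
  also have "\<dots> = - (s *\<^sub>R (cnj \<mu> *\<^sub>C T0 y))"
    using T0.radial_pencil[of y s \<mu>] by (simp add: z_def x_def)
  finally have "norm ((y0 - y) - cnj z *\<^sub>C T0 (y0 - y)) = s * norm (T0 y)" using s \<mu> by simp
  also have "\<dots> \<le> s * \<rho>" using T0.bound[of y] y(1) s by (intro mult_left_mono) auto
  finally have "2 / \<delta> * norm ((y0 - y) - cnj z *\<^sub>C T0 (y0 - y)) \<le> 2 / \<delta> * (s * \<rho>)"
    using \<delta>(1) by (intro mult_left_mono) auto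
  then have y0y: "norm (y0 - y) \<le> 2 / \<delta> * (s * \<rho>)"
    using T0.radial_resolvent_bound[OF \<mu> \<delta> less_imp_le[OF s(1)] s_le, of "y0 - y"] by (simp add: z_def)
  define X where "X = 2 / \<delta> * (s * \<rho>) * (1 + \<rho>)"
  have "inner y0 x = \<eta> + inner (y0 - y) x" by (simp add: \<eta>_def inner_diff_left)
  also have "inner (y0 - y) x \<le> norm (y0 - y) * norm x" by (rule norm_cauchy_schwarz)
  also have "\<dots> \<le> X" unfolding X_def using y0y x_upper s \<rho> \<delta>(1) by (intro mult_mono) auto
  finally have "2 * inner y0 x + (\<rho> - 2) * (norm x)\<^sup>2 \<le> 2 * (\<eta> + X)"
    using N(2) by (simp add: left_diff_distrib)
  then have "c\<^sup>2 * (2 * inner y0 x + (\<rho> - 2) * (norm x)\<^sup>2) \<le> c\<^sup>2 * (2 * (\<eta> + X))"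
    by (rule mult_left_mono) simp
  with harnack[OF z y0 y1]
  have harn: "2 * inner y1 x + (\<rho> - 2) * (norm x)\<^sup>2 \<le> c\<^sup>2 * (2 * (\<eta> + X))" by (rule order_trans)
  have upper: "inner y1 x \<le> (1 + c\<^sup>2) * \<eta> + s * (c\<^sup>2 * (2 / \<delta> * \<rho> * (1 + \<rho>)))"
  proof -
    have "c\<^sup>2 * (2 * (\<eta> + X)) = 2 * (c\<^sup>2 * \<eta>) + 2 * (c\<^sup>2 * X)" by (simp add: algebra_simps)
    with harn N(1) have "inner y1 x \<le> \<eta> + c\<^sup>2 * \<eta> + c\<^sup>2 * X"
      unfolding left_diff_distrib by linarith
    also have "c\<^sup>2 * X = s * (c\<^sup>2 * (2 / \<delta> * \<rho> * (1 + \<rho>)))" by (simp add: X_def)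
    finally show ?thesis by (simp only: distrib_right mult_1)
  qed
  \<comment> \<open>\<open>y1\<close> cannot degenerate: its image \<open>x\<close> has norm at
    least \<open>\<delta>\<close>, and the pencil of \<open>T1\<close> has norm at most
    \<open>1 + \<rho>\<close>.\<close>
  have "\<delta> \<le> norm y1 * (1 + \<rho>)"
  proof -
    have "norm x \<le> norm y1 + cmod z * norm (T1 y1)"
      using norm_triangle_ineq4[of y1 "cnj z *\<^sub>C T1 y1"] y1 by simp
    also have "cmod z * norm (T1 y1) \<le> 1 * (\<rho> * norm y1)" using z T1.bound[of y1] \<rho> by (intro mult_mono) auto
    finally show ?thesis using x_lower by (simp add: algebra_simps)
  qed
  then have "\<delta> / (1 + \<rho>) \<le> norm y1" using \<rho> by (simp add: pos_divide_le_eq)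
  then have y1_lower: "\<kappa> \<le> (norm y1)\<^sup>2" unfolding \<kappa>_def using \<delta>(1) \<rho> by (intro power_mono) auto
  then have y1_pos: "0 < norm y1" using \<kappa> by (cases "y1 = 0") auto
  have "y1 - cnj \<mu> *\<^sub>C T1 y1 = x - s *\<^sub>R (cnj \<mu> *\<^sub>C T1 y1)"
    using T1.radial_pencil[of y1 s \<mu>, folded z_def, unfolded y1] by simp
  then have "inner y1 (y1 - cnj \<mu> *\<^sub>C T1 y1) = inner y1 x + s * inner (- y1) (cnj \<mu> *\<^sub>C T1 y1)"
    by (simp add: inner_diff_right)
  also have "inner (- y1) (cnj \<mu> *\<^sub>C T1 y1) \<le> norm y1 * (\<rho> * norm y1)"
    using norm_cauchy_schwarz[of "- y1" "cnj \<mu> *\<^sub>C T1 y1"] mult_left_mono[OF T1.bound[of y1], of "norm y1"] \<mu>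
    by simp
  finally have "inner y1 (y1 - cnj \<mu> *\<^sub>C T1 y1) \<le> inner y1 x + s * (norm y1 * (\<rho> * norm y1))" using s by simp
  also have "\<dots> \<le> (1 + c\<^sup>2) * \<eta> + s * (c\<^sup>2 * (2 / \<delta> * \<rho> * (1 + \<rho>))) + s * \<rho> * (norm y1)\<^sup>2"
    using upper by (simp add: power2_eq_square)
  \<comment> \<open>The lower bound \<open>\<kappa>\<close> turns the constant terms into multiples
    of \<open>(norm y1)\<^sup>2\<close>, as normalizing \<open>y1\<close> requires.\<close>
  also have "\<dots> \<le> ((1 + c\<^sup>2) * \<eta> + s * (c\<^sup>2 * (2 / \<delta> * \<rho> * (1 + \<rho>))) + s * (\<kappa> * \<rho>)) / \<kappa> * (norm y1)\<^sup>2"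
  proof -
    have "0 \<le> \<eta>" using N by simp
    then have "0 \<le> (1 + c\<^sup>2) * \<eta> + s * (c\<^sup>2 * (2 / \<delta> * \<rho> * (1 + \<rho>)))" using s \<delta>(1) \<rho> by simp
    then have "((1 + c\<^sup>2) * \<eta> + s * (c\<^sup>2 * (2 / \<delta> * \<rho> * (1 + \<rho>)))) * \<kappa> \<le>
        ((1 + c\<^sup>2) * \<eta> + s * (c\<^sup>2 * (2 / \<delta> * \<rho> * (1 + \<rho>)))) * (norm y1)\<^sup>2"
      using y1_lower by (intro mult_left_mono)
    then have "(1 + c\<^sup>2) * \<eta> + s * (c\<^sup>2 * (2 / \<delta> * \<rho> * (1 + \<rho>))) \<le>
        ((1 + c\<^sup>2) * \<eta> + s * (c\<^sup>2 * (2 / \<delta> * \<rho> * (1 + \<rho>)))) / \<kappa> * (norm y1)\<^sup>2"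
      using \<kappa> by (simp only: times_divide_eq_left pos_le_divide_eq)
    moreover have "s * (\<kappa> * \<rho>) / \<kappa> * (norm y1)\<^sup>2 = s * \<rho> * (norm y1)\<^sup>2" using \<kappa> by simp
    ultimately show ?thesis by (simp only: add_divide_distrib distrib_right)
  qed
  also have "\<dots> = ((1 + c\<^sup>2) * \<eta> + s * L) / \<kappa> * (norm y1)\<^sup>2" by (simp add: L_def distrib_left)
  also have "\<dots> < \<epsilon> * (norm y1)\<^sup>2"
  proof (rule mult_strict_right_mono)
    have "(1 + c\<^sup>2) * \<eta> + s * L < \<epsilon> * \<kappa>" using \<eta> sL mult_pos_pos[OF \<kappa> \<epsilon>] by (simp add: mult.commute)
    then show "((1 + c\<^sup>2) * \<eta> + s * L) / \<kappa> < \<epsilon>" using \<kappa> by (simp add: pos_divide_less_eq)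
  qed (use y1_pos in simp)
  finally have fin: "inner y1 (y1 - cnj \<mu> *\<^sub>C T1 y1) < \<epsilon> * (norm y1)\<^sup>2" .
  define u where "u = (1 / norm y1) *\<^sub>R y1"
  have "u - cnj \<mu> *\<^sub>C T1 u = (1 / norm y1) *\<^sub>R (y1 - cnj \<mu> *\<^sub>C T1 y1)"
    by (simp add: u_def T1.scaleR scaleC_scaleR scaleR_diff_right)
  then have "inner u (u - cnj \<mu> *\<^sub>C T1 u) = inner y1 (y1 - cnj \<mu> *\<^sub>C T1 y1) / (norm y1)\<^sup>2"
    by (simp add: u_def power2_eq_square)
  with fin y1_pos have "inner u (u - cnj \<mu> *\<^sub>C T1 u) < \<epsilon>" by (simp add: pos_divide_less_eq)
  moreover have "norm u = 1" using y1_pos by (simp add: u_def)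
  ultimately show "\<exists>y. norm y = 1 \<and> inner y (y - cnj \<mu> *\<^sub>C T1 y) < \<epsilon>" by blast
qed

text \<open>
  As a function of \<open>cnj z\<close> the difference of the two sides of the Harnack inequality is the real part
  of a power series, whose first two coefficients are compared.
\<close>

lemma numerical_form_dominated:
  "cmod (c\<^sup>2 * cinner (T0 x) x - cinner (T1 x) x) \<le> \<rho> * (c\<^sup>2 - 1) * (norm x)\<^sup>2"
proof -
  have "\<forall>w. \<exists>y. cmod w < 1 \<longrightarrow> y - w *\<^sub>C T0 y = x"
    using T0.resolvent_exists[of "cnj w" x for w] by simp
  then obtain R0 where R0: "\<And>w. cmod w < 1 \<Longrightarrow> R0 w - w *\<^sub>C T0 (R0 w) = x" by metis
  have "\<forall>w. \<exists>y. cmod w < 1 \<longrightarrow> y - w *\<^sub>C T1 y = x"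
    using T1.resolvent_exists[of "cnj w" x for w] by simp
  then obtain R1 where R1: "\<And>w. cmod w < 1 \<Longrightarrow> R1 w - w *\<^sub>C T1 (R1 w) = x" by metis
  \<comment> \<open>\<open>k\<close> gathers the scalar parts of the kernels. It enters only the
    coefficient of order 0 and changes its factor 2 into \<open>\<rho>\<close>.\<close>
  define k where "k = (\<rho> - 2) * (c\<^sup>2 - 1) * (norm x)\<^sup>2"
  define t0 where "t0 = (\<lambda>n. cinner ((T0 ^^ n) x) x)"
  define t1 where "t1 = (\<lambda>n. cinner ((T1 ^^ n) x) x)"
  define a where "a = (\<lambda>n. 2 * (c\<^sup>2 * t0 n - t1 n) + (if n = 0 then complex_of_real k else 0))"
  define F where "F = (\<lambda>w. 2 * (c\<^sup>2 * cinner (R0 w) x - cinner (R1 w) x) + k)"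
  have "cmod (a 1) \<le> 2 * (\<rho> * (c\<^sup>2 - 1) * (norm x)\<^sup>2)"
  proof (rule caratheodory_first_coefficient[where F = F])
    fix w :: complex assume w: "cmod w < 1"
    have s0: "(\<lambda>n. w ^ n * t0 n) sums cinner (R0 w) x"
      using T0.cinner_resolvent_sums[of "cnj w" "R0 w" x x] R0[OF w] w by (simp add: t0_def)
    have s1: "(\<lambda>n. w ^ n * t1 n) sums cinner (R1 w) x"
      using T1.cinner_resolvent_sums[of "cnj w" "R1 w" x x] R1[OF w] w by (simp add: t1_def)
    have "(\<lambda>n. 2 * (c\<^sup>2 * (w ^ n * t0 n) - w ^ n * t1 n) + (if n = 0 then complex_of_real k else 0)) sums F w"
      unfolding F_def by (intro sums_add sums_mult sums_diff s0 s1) (rule sums_single)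
    moreover have "2 * (c\<^sup>2 * (w ^ n * t0 n) - w ^ n * t1 n) + (if n = 0 then complex_of_real k else 0) = a n * w ^ n" for n
      by (simp add: a_def algebra_simps)
    ultimately show "(\<lambda>n. a n * w ^ n) sums F w" by simp
    have "2 * inner (R1 w) x + (\<rho> - 2) * (norm x)\<^sup>2 \<le> c\<^sup>2 * (2 * inner (R0 w) x + (\<rho> - 2) * (norm x)\<^sup>2)"
      using harnack[of "cnj w" "R0 w" x "R1 w"] R0[OF w] R1[OF w] w by simp
    then show "0 \<le> Re (F w)"
      by (simp add: F_def k_def Re_cinner algebra_simps flip: of_real_power)
  next
    show "a 0 = complex_of_real (\<rho> * (c\<^sup>2 - 1) * (norm x)\<^sup>2)"
      by (simp add: a_def t0_def t1_def k_def cinner_self algebra_simps)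
  qed
  moreover have "a 1 = 2 * (c\<^sup>2 * cinner (T0 x) x - cinner (T1 x) x)" by (simp add: a_def t0_def t1_def)
  ultimately have "cmod (2 * (c\<^sup>2 * cinner (T0 x) x - cinner (T1 x) x)) \<le> 2 * (\<rho> * (c\<^sup>2 - 1) * (norm x)\<^sup>2)"
    by (simp only:)
  then show ?thesis unfolding norm_mult by simp
qed

text \<open>For \<open>\<rho> = 1\<close> the bound on the numerical forms is
  \<open>c\<^sup>2 - 1\<close>, exactly the difference of the constants in the two tangent
  distances, so the distance for \<open>T1\<close> is at most \<open>c\<^sup>2\<close> times that
  for \<open>T0\<close>.\<close>

lemma closure_numerical_range_transfer_contraction:
  assumes \<mu>: "cmod \<mu> = 1" and \<rho>: "\<rho> = 1" and cl: "\<mu> \<in> closure (numerical_range T0)"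
  shows "\<mu> \<in> closure (numerical_range T1)"
  unfolding T1.closure_numerical_range_iff[OF \<mu>]
proof (intro allI impI)
  fix \<epsilon> :: real assume "0 < \<epsilon>"
  moreover have c: "0 < 1 + c\<^sup>2" by (simp add: add_pos_nonneg)
  ultimately obtain y where y: "norm y = 1" "inner y (y - cnj \<mu> *\<^sub>C T0 y) < \<epsilon> / (1 + c\<^sup>2)"
    using cl unfolding T0.closure_numerical_range_iff[OF \<mu>] by (meson divide_pos_pos)
  have "Re (cnj \<mu> * (c\<^sup>2 * cinner (T0 y) y - cinner (T1 y) y)) \<le> c\<^sup>2 - 1"
    using complex_Re_le_cmod[of "cnj \<mu> * (c\<^sup>2 * cinner (T0 y) y - cinner (T1 y) y)"]
      numerical_form_dominated[of y] \<mu> \<rho> y(1) by (simp add: norm_mult)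
  then have "inner y (y - cnj \<mu> *\<^sub>C T1 y) \<le> c\<^sup>2 * inner y (y - cnj \<mu> *\<^sub>C T0 y)"
    unfolding inner_pencil using y(1) by (simp add: algebra_simps)
  \<comment> \<open>The factor \<open>1 + c\<^sup>2\<close> is positive whatever \<open>c\<close>
    is, so the choice of \<open>y\<close> could divide by it.\<close>
  also have "\<dots> \<le> (1 + c\<^sup>2) * inner y (y - cnj \<mu> *\<^sub>C T0 y)"
    using T0.positive[of \<mu> y] \<mu> \<rho> by (simp add: distrib_right) (smt (verit) zero_le_power2)
  also have "\<dots> < \<epsilon>" using y(2) c by (simp add: pos_less_divide_eq mult.commute)
  finally show "\<exists>y. norm y = 1 \<and> inner y (y - cnj \<mu> *\<^sub>C T1 y) < \<epsilon>" using y(1) by blast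
qed

end

section \<open>Assembly of the three assertions\<close>

lemma harnack_dominated_imp_harnack_pair:
  assumes "rho_contraction T0 \<rho>" and "rho_contraction T1 \<rho>" and "harnack_dominated \<rho> T1 T0"
  obtains c where "harnack_pair T0 T1 \<rho> c"
proof -
  interpret T0: rho_contraction T0 \<rho> by fact
  interpret T1: rho_contraction T1 \<rho> by fact
  show ?thesis
  proof (rule harnack_dominatedE[OF assms(3) T0.power_bounded_op_axioms T1.power_bounded_op_axioms])
    fix c
    assume "\<And>z y0 y1 x. cmod z < 1 \<Longrightarrow> y0 - cnj z *\<^sub>C T0 y0 = x \<Longrightarrow> y1 - cnj z *\<^sub>C T1 y1 = x \<Longrightarrow>
      2 * inner y1 x + (\<rho> - 2) * (norm x)\<^sup>2 \<le> c\<^sup>2 * (2 * inner y0 x + (\<rho> - 2) * (norm x)\<^sup>2)"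
    then have "harnack_pair T0 T1 \<rho> c" by unfold_locales
    then show ?thesis by (rule that)
  qed
qed

theorem theorem2p14:
  fixes T0 T1 :: "'a::complex_hilbert_space \<Rightarrow> 'a" and \<rho> :: real
  assumes "1 \<le> \<rho>" and "\<rho> \<le> 2"
    and "T0 \<in> C_rho TYPE('k0::complex_hilbert_space) \<rho>"
    and "T1 \<in> C_rho TYPE('k1::complex_hilbert_space) \<rho>"
  shows "(\<rho> = 1 \<and> harnack_dominated \<rho> T1 T0 \<longrightarrow>
            closure (numerical_range T0) \<inter> sphere 0 1 = closure (numerical_range T1) \<inter> sphere 0 1) \<and>
         (1 < \<rho> \<and> \<rho> \<le> 2 \<and> harnack_dominated \<rho> T1 T0 \<and> peripheral_spectrum T0 = {} \<longrightarrow>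
            closure (numerical_range T0) \<inter> sphere 0 1 \<subseteq> closure (numerical_range T1) \<inter> sphere 0 1) \<and>
         (harnack_equivalent \<rho> T1 T0 \<longrightarrow>
            closure (numerical_range T0) \<inter> sphere 0 1 = closure (numerical_range T1) \<inter> sphere 0 1)"
proof -
  have rc: "rho_contraction T0 \<rho>" "rho_contraction T1 \<rho>"
    using C_rho_imp_rho_contraction assms by blast+
  interpret T0: rho_contraction T0 \<rho> by (rule rc)
  interpret T1: rho_contraction T1 \<rho> by (rule rc)
  \<comment> \<open>The two dominations serve different points: approximate eigenvalues pass to
    \<open>S\<close> because \<open>S\<close> dominates \<open>T\<close>, all other points of the
    closure because \<open>T\<close> dominates \<open>S\<close>.\<close>
  have transfer: "\<mu> \<in> closure (numerical_range S)"
    if rc': "rho_contraction T \<rho>" "rho_contraction S \<rho>"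
      and dom: "harnack_dominated \<rho> S T" "harnack_dominated \<rho> T S"
      and \<mu>: "cmod \<mu> = 1" "\<mu> \<in> closure (numerical_range T)"
    for S T :: "'a \<Rightarrow> 'a" and \<mu>
  proof (cases "approx_eigenvalue T \<mu>")
    case True
    obtain c where "harnack_pair S T \<rho> c"
      using harnack_dominated_imp_harnack_pair[OF rc'(2,1) dom(2)] .
    from this \<mu>(1) True have "approx_eigenvalue S \<mu>" by (rule harnack_pair.approx_eigenvalue_transfer)
    with rc'(2) \<mu>(1) show ?thesis by (rule rho_contraction.approx_eigenvalue_imp_closure_numerical_range)
  next
    case False
    obtain c where "harnack_pair T S \<rho> c"
      using harnack_dominated_imp_harnack_pair[OF rc' dom(1)] .
    from this \<mu> False show ?thesis by (rule harnack_pair.closure_numerical_range_transfer)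
  qed
  show ?thesis
  proof (intro conjI impI)
    assume "\<rho> = 1 \<and> harnack_dominated \<rho> T1 T0"
    then have \<rho>: "\<rho> = 1" and dom: "harnack_dominated \<rho> T1 T0" by blast+
    obtain c where "harnack_pair T0 T1 \<rho> c" using harnack_dominated_imp_harnack_pair[OF rc dom] .
    then interpret harnack_pair T0 T1 \<rho> c .
    \<comment> \<open>Since \<open>\<rho> = 1 < 2\<close>, every unimodular point of the closure for
      \<open>T1\<close> is an approximate eigenvalue, and these pass to the dominating
      operator.\<close>
    have "\<mu> \<in> closure (numerical_range T0)" if "cmod \<mu> = 1" "\<mu> \<in> closure (numerical_range T1)" for \<mu>
    proof -
      have "approx_eigenvalue T1 \<mu>"
        using that \<rho> by (intro T1.closure_numerical_range_imp_approx_eigenvalue) auto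
      with that(1) have "approx_eigenvalue T0 \<mu>" by (rule approx_eigenvalue_transfer)
      with that(1) show ?thesis by (rule T0.approx_eigenvalue_imp_closure_numerical_range)
    qed
    then have "\<mu> \<in> closure (numerical_range T0) \<longleftrightarrow> \<mu> \<in> closure (numerical_range T1)" if "cmod \<mu> = 1" for \<mu>
      using that closure_numerical_range_transfer_contraction[OF that \<rho>] by blast
    then show "closure (numerical_range T0) \<inter> sphere 0 1 = closure (numerical_range T1) \<inter> sphere 0 1" by auto
  next
    assume "1 < \<rho> \<and> \<rho> \<le> 2 \<and> harnack_dominated \<rho> T1 T0 \<and> peripheral_spectrum T0 = {}"
    then have dom: "harnack_dominated \<rho> T1 T0" and empty: "peripheral_spectrum T0 = {}" by simp_all
    obtain c where "harnack_pair T0 T1 \<rho> c" using harnack_dominated_imp_harnack_pair[OF rc dom] .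
    then interpret harnack_pair T0 T1 \<rho> c .
    \<comment> \<open>The empty peripheral spectrum leaves only the case in which the single
      domination of \<open>T1\<close> by \<open>T0\<close> suffices.\<close>
    have "\<not> approx_eigenvalue T0 \<mu>" if "cmod \<mu> = 1" for \<mu>
      using approx_eigenvalue_imp_peripheral_spectrum[OF T0.power_bounded_op_axioms that] empty by blast
    then have "\<mu> \<in> closure (numerical_range T1)"
      if "cmod \<mu> = 1" "\<mu> \<in> closure (numerical_range T0)" for \<mu>
      using that closure_numerical_range_transfer by blast
    then show "closure (numerical_range T0) \<inter> sphere 0 1 \<subseteq> closure (numerical_range T1) \<inter> sphere 0 1" by auto
  next
    assume "harnack_equivalent \<rho> T1 T0"
    then have dom: "harnack_dominated \<rho> T1 T0" "harnack_dominated \<rho> T0 T1"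
      by (simp_all add: harnack_equivalent_def)
    have "\<mu> \<in> closure (numerical_range T0) \<longleftrightarrow> \<mu> \<in> closure (numerical_range T1)" if "cmod \<mu> = 1" for \<mu>
      using transfer[OF rc dom that] transfer[OF rc(2,1) dom(2,1) that] by blast
    then show "closure (numerical_range T0) \<inter> sphere 0 1 = closure (numerical_range T1) \<inter> sphere 0 1" by auto
  qed
qed

end
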